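(* Let $K$ be an integer and let $A$ be a finite set of positive integers with $|AA|\leq K|A|$, where $|A|$ is sufficiently large (in terms of $K$). Let $k\geq 1$ be an integer. Then for any integer $u$ coprime with every element of $A$, $$\Lambda_k(A+u)\leq (2k^2)^K,$$ and in particular $$|(A+u)^{(k)}|\geq \frac{|A|^k}{(2k^2)^{kK}}.$$
   Context: $AA=\{ab: a,b\in A\}$, $A+u=\{a+u:a\in A\}$, and $B^{(k)}=\{b_1\cdots b_k: b_i\in B\}$. For a finite set $B=\{b_1,\dots,b_N\}$ and non-negative real weights $w=(w_1,\dots,w_N)$, $E_{k,w}(B)=\sum w_{i_1}\cdots w_{i_{2k}}$, summing over all $2k$-tuples of indices with $b_{i_1}\cdots b_{i_k}=b_{i_{k+1}}\cdots b_{i_{2k}}$; $\Lambda_k(B)=\max_w E_{k,w}(B)^{1/k}$ over all non-negative weights with $\sum_i w_i^2=1$.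
   Formalization: The bound on Λ_k(A+u) is proved only when 0 is not in A+u, i.e. excluding u = -1 with 1 in A, where it fails (e.g. A = {1,2,4,...,2^(n-1)}, K = k = 2, n large); the lower bound for |(A+u)^(k)| is proved for every u. *)

theory Defs
  imports "HOL-Analysis.Analysis"
begin

definition product_set :: "'a::comm_monoid_mult set \<Rightarrow> 'a set" where
  "product_set A = {a * b | a b. a \<in> A \<and> b \<in> A}"

definition shift_set :: "'a::plus set \<Rightarrow> 'a \<Rightarrow> 'a set" where
  "shift_set A u = (\<lambda>a. a + u) ` A"

definition iterated_product_set :: "'a::comm_monoid_mult set \<Rightarrow> nat \<Rightarrow> 'a set" where
  "iterated_product_set B k = {\<Prod>i<k. b i | b. \<forall>i<k. b i \<in> B}"

text \<open>
  The weights are indexed by the elements of \<open>B\<close> themselves instead of by an enumeration of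
  \<open>B\<close>. A \<open>2k\<close>-tuple is an extensional function on \<open>{..<2*k}\<close>; its first \<open>k\<close> entries form
  the left-hand side of the multiplicative equation and its last \<open>k\<close> entries the right-hand side.
\<close>

definition weighted_energy :: "nat \<Rightarrow> ('a::comm_monoid_mult \<Rightarrow> real) \<Rightarrow> 'a set \<Rightarrow> real" where
  "weighted_energy k w B =
     (\<Sum>b \<in> {b \<in> {..<2*k} \<rightarrow>\<^sub>E B. (\<Prod>i<k. b i) = (\<Prod>i=k..<2*k. b i)}. \<Prod>i<2*k. w (b i))"

definition unit_weights :: "'a set \<Rightarrow> ('a \<Rightarrow> real) set" where
  "unit_weights B = {w. (\<forall>b\<in>B. 0 \<le> w b) \<and> (\<Sum>b\<in>B. (w b)\<^sup>2) = 1}"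

definition Lambda_const :: "nat \<Rightarrow> 'a::comm_monoid_mult set \<Rightarrow> real" where
  "Lambda_const k B = (SUP w \<in> unit_weights B. weighted_energy k w B powr (1 / real k))"

text \<open>For finite nonempty \<open>B\<close> the supremum above is a maximum.\<close>

lemma weighted_energy_cong:
  assumes "\<And>b. b \<in> B \<Longrightarrow> w b = w' b"
  shows "weighted_energy k w B = weighted_energy k w' B"
  unfolding weighted_energy_def
  by (intro sum.cong refl prod.cong) (auto intro!: assms simp: PiE_iff)

lemma weighted_energy_nonneg:
  assumes "\<And>b. b \<in> B \<Longrightarrow> 0 \<le> w b"
  shows "0 \<le> weighted_energy k w B"
  unfolding weighted_energy_def
  by (intro sum_nonneg prod_nonneg) (auto intro!: assms simp: PiE_iff)

lemma Lambda_const_is_max: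
  fixes B :: "'a::comm_monoid_mult set"
  assumes "finite B" "B \<noteq> {}"
  shows "\<exists>w\<in>unit_weights B. Lambda_const k B = weighted_energy k w B powr (1 / real k) \<and>
           (\<forall>v\<in>unit_weights B.
              weighted_energy k v B powr (1 / real k) \<le> weighted_energy k w B powr (1 / real k))"
proof -
  define P :: "('a \<Rightarrow> real) set" where
    "P = (\<Pi>\<^sub>E b\<in>UNIV. if b \<in> B then {0..1} else {0})"
  define C where "C = P \<inter> {w. (\<Sum>b\<in>B. (w b)\<^sup>2) = 1}"
  have P: "compact P"
  proof -
    have "compactin (product_topology (\<lambda>b::'a. euclidean :: real topology) UNIV) P"
      unfolding P_def by (subst compactin_PiE) auto
    then show ?thesis
      unfolding euclidean_product_topology compactin_euclidean_iff .
  qed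
  have coord: "continuous_on UNIV (\<lambda>w :: 'a \<Rightarrow> real. w b)" for b
    by (rule continuous_on_product_coordinates)
  have "closed {w :: 'a \<Rightarrow> real. (\<Sum>b\<in>B. (w b)\<^sup>2) = 1}"
    by (intro closed_Collect_eq continuous_intros coord)
  then have C: "compact C"
    unfolding C_def using P by (rule compact_Int_closed[rotated])
  have C_sub: "C \<subseteq> unit_weights B"
    unfolding C_def P_def unit_weights_def by (auto simp: PiE_iff split: if_splits)
  have trunc: "(\<lambda>b. if b \<in> B then w b else 0) \<in> C" if w: "w \<in> unit_weights B" for w
  proof -
    have "w b \<le> 1" if "b \<in> B" for b
    proof -
      have "(w b)\<^sup>2 \<le> (\<Sum>b\<in>B. (w b)\<^sup>2)"
        using that assms by (intro member_le_sum) auto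
      also have "\<dots> = 1" using w by (simp add: unit_weights_def)
      finally show ?thesis using abs_square_le_1[of "w b"] by linarith
    qed
    moreover have "(\<Sum>b\<in>B. (if b \<in> B then w b else 0)\<^sup>2) = 1"
      using w by (simp add: unit_weights_def cong: sum.cong)
    ultimately show ?thesis
      using w unfolding C_def P_def unit_weights_def by (auto simp: PiE_iff)
  qed
  obtain b0 where b0: "b0 \<in> B" using assms by blast
  have "(\<lambda>b. if b = b0 then 1 else 0) \<in> unit_weights B"
    using b0 assms by (simp add: unit_weights_def if_distrib[of "\<lambda>x. x\<^sup>2"] cong: if_cong)
  then have "C \<noteq> {}" using trunc by blast
  moreover have "continuous_on C (\<lambda>w. weighted_energy k w B)"
    unfolding weighted_energy_def
    by (intro continuous_on_sum continuous_on_prod continuous_on_subset[OF coord]) auto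
  ultimately obtain w where w: "w \<in> C"
    and wmax: "\<And>v. v \<in> C \<Longrightarrow> weighted_energy k v B \<le> weighted_energy k w B"
    using continuous_attains_sup[OF C] by blast
  have max: "weighted_energy k v B powr (1 / real k) \<le> weighted_energy k w B powr (1 / real k)"
    if v: "v \<in> unit_weights B" for v
  proof (rule powr_mono2)
    show "0 \<le> weighted_energy k v B"
      using v by (intro weighted_energy_nonneg) (simp add: unit_weights_def)
    have "weighted_energy k v B = weighted_energy k (\<lambda>b. if b \<in> B then v b else 0) B"
      by (rule weighted_energy_cong) simp
    also have "\<dots> \<le> weighted_energy k w B" by (rule wmax[OF trunc[OF v]])
    finally show "weighted_energy k v B \<le> weighted_energy k w B" .
  qed simp
  have "Lambda_const k B = weighted_energy k w B powr (1 / real k)"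
    unfolding Lambda_const_def
    by (rule cSup_eq_maximum) (use w C_sub max in auto)
  then show ?thesis using w C_sub max by blast
qed

end

theory Submission
  imports
    Defs
    "HOL-Library.Function_Algebras"
    "HOL-Computational_Algebra.Group_Closure"
    "HOL-Number_Theory.Residue_Primitive_Roots"
begin

text \<open>
  A multiplicative version of Freiman's lemma shows that the prime exponent vectors of \<open>A\<close> span an
  affine space of dimension \<open>d < K\<close>: successively remove the minimum \<open>a\<close> of \<open>A\<close>; the products
  \<open>a b\<close> that are lost include those with \<open>b / a\<close> irreducible among the ratios, and the
  irreducible ratios generate all of them. Hence \<open>d\<close> primes suffice to separate the elements of
  \<open>A\<close> by their valuations.

  Now split \<open>A\<close> by the valuation at one prime \<open>p\<close>. In a solution of
  \<open>(a\<^sub>1 + u) \<cdots> (a\<^sub>k + u) = (a\<^bsub>k+1\<^esub> + u) \<cdots> (a\<^bsub>2k\<^esub> + u)\<close> the smallest valuation is attained at least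
  twice, because \<open>u\<close> is prime to \<open>p\<close>. Summing over the pair of positions and applying Hoelder's
  inequality to the Fourier transforms shows that the best energy constant of \<open>A + u\<close> is at most
  \<open>2 k\<^sup>2\<close> times the largest one of the parts. After \<open>d\<close> primes the parts are singletons, whose
  constant is \<open>1\<close>.
\<close>

subsection \<open>Determining sets of coordinates\<close>

lemma group_closure_least:
  fixes T :: "'a::ab_group_add set"
  assumes "S \<subseteq> group_closure T"
  shows "group_closure S \<subseteq> group_closure T"
proof
  fix x assume "x \<in> group_closure S"
  then show "x \<in> group_closure T"
    by induction (use assms in \<open>auto intro: group_closure.diff\<close>)
qed

text \<open>A substitute for rank: for a group \<open>G\<close> this says that the projection to the
  coordinates in \<open>P\<close> is injective on \<open>G\<close>.\<close>

definition determining :: "'i set \<Rightarrow> ('i \<Rightarrow> int) set \<Rightarrow> bool" where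
  "determining P G \<longleftrightarrow> (\<forall>x\<in>G. (\<forall>p\<in>P. x p = 0) \<longrightarrow> x = 0)"

lemma determining_antimono: "determining P G \<Longrightarrow> H \<subseteq> G \<Longrightarrow> determining P H"
  unfolding determining_def by blast

lemma group_closure_scale:
  fixes x :: "'i \<Rightarrow> int" and c :: int
  assumes "x \<in> group_closure S"
  shows "(\<lambda>i. c * x i) \<in> group_closure S"
proof -
  have n: "(\<lambda>i. int n * x i) \<in> group_closure S" for n
  proof (induction n)
    case 0
    have "(\<lambda>i. int 0 * x i) = 0" by (simp add: fun_eq_iff)
    then show ?case by simp
  next
    case (Suc n)
    have "(\<lambda>i. int (Suc n) * x i) = (\<lambda>i. int n * x i) + x"
      by (simp add: fun_eq_iff algebra_simps)
    then show ?case using Suc assms group_closure_add by metis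
  qed
  show ?thesis
  proof (cases "c \<ge> 0")
    case True
    then show ?thesis using n[of "nat c"] by simp
  next
    case False
    have "(\<lambda>i. c * x i) = - (\<lambda>i. int (nat (- c)) * x i)"
      using False by (simp add: fun_eq_iff)
    then show ?thesis using n[of "nat (- c)"] by (metis group_closure_minus_iff)
  qed
qed

lemma group_closure_insertE:
  fixes x :: "'i \<Rightarrow> int"
  assumes "x \<in> group_closure (insert s S)"
  shows "\<exists>c y. y \<in> group_closure S \<and> x = (\<lambda>i. y i + c * s i)"
  using assms
proof induction
  case (base t)
  consider "t = s" | "t \<in> insert 0 S" using base by blast
  then show ?case
  proof cases
    case 1
    then have "t = (\<lambda>i. 0 i + 1 * s i)" by (simp add: fun_eq_iff)
    then show ?thesis using zero_in_group_closure by blast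
  next
    case 2
    then have "t \<in> group_closure S" by (rule group_closure.base)
    moreover have "t = (\<lambda>i. t i + 0 * s i)" by simp
    ultimately show ?thesis by blast
  qed
next
  case (diff v w)
  then obtain c y d z where "y \<in> group_closure S" "v = (\<lambda>i. y i + c * s i)"
    "z \<in> group_closure S" "w = (\<lambda>i. z i + d * s i)" by blast
  moreover from this have "v - w = (\<lambda>i. (y - z) i + (c - d) * s i)"
    by (simp add: fun_eq_iff algebra_simps)
  ultimately show ?case using group_closure.diff by blast
qed

text \<open>A new generator raises the rank by at most one. If some nonzero \<open>v\<close> in the
  enlarged group vanishes on \<open>P\<close>, any coordinate where \<open>v\<close> does not vanish
  can be added; otherwise \<open>P\<close> already suffices.\<close>

lemma determining_insert:
  fixes s :: "'i \<Rightarrow> int"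
  assumes P: "determining P (group_closure S)"
  shows "\<exists>p. determining (insert p P) (group_closure (insert s S))"
proof (cases "determining P (group_closure (insert s S))")
  case True
  then show ?thesis unfolding determining_def by blast
next
  case False
  then obtain v where v: "v \<in> group_closure (insert s S)" "\<forall>p\<in>P. v p = 0" "v \<noteq> 0"
    unfolding determining_def by blast
  then obtain p where p: "v p \<noteq> 0" by (auto simp: fun_eq_iff)
  obtain c y where y: "y \<in> group_closure S" and v_eq: "v = (\<lambda>i. y i + c * s i)"
    using group_closure_insertE[OF v(1)] by blast
  have c: "c \<noteq> 0"
  proof
    assume "c = 0"
    then have "v \<in> group_closure S" using y v_eq by simp
    then show False using P v unfolding determining_def by blast
  qed
  \<comment> \<open>Eliminating \<open>s\<close> between \<open>x\<close> and \<open>v\<close> puts \<open>c x - d v\<close> into the group generated by \<open>S\<close>.\<close>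
  have "x = 0" if x: "x \<in> group_closure (insert s S)" "\<forall>q\<in>insert p P. x q = 0" for x
  proof -
    obtain d z where z: "z \<in> group_closure S" and x_eq: "x = (\<lambda>i. z i + d * s i)"
      using group_closure_insertE[OF x(1)] by blast
    define r where "r = (\<lambda>i. c * z i) - (\<lambda>i. d * y i)"
    have r: "r i = c * x i - d * v i" for i
      by (simp add: r_def x_eq v_eq algebra_simps)
    have "r \<in> group_closure S"
      unfolding r_def using y z by (intro group_closure.diff group_closure_scale)
    moreover have "\<forall>q\<in>P. r q = 0" using r x(2) v(2) by simp
    ultimately have r0: "r = 0" using P unfolding determining_def by blast
    then have "c * x p = d * v p" using r[of p] by simp
    then have "d = 0" using x(2) p by simp
    then have "c * x i = 0" for i using r[of i] r0 by simp
    then show ?thesis using c by (simp add: fun_eq_iff)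
  qed
  then show ?thesis unfolding determining_def by blast
qed

lemma determining_exists:
  fixes S :: "('i \<Rightarrow> int) set"
  assumes "finite S"
  shows "\<exists>P. finite P \<and> card P \<le> card S \<and> determining P (group_closure S)"
  using assms
proof induction
  case empty
  show ?case by (intro exI[of _ "{}"]) (simp add: determining_def)
next
  case (insert s S)
  then obtain P where P: "finite P" "card P \<le> card S" "determining P (group_closure S)"
    by blast
  obtain p where "determining (insert p P) (group_closure (insert s S))"
    using determining_insert[OF P(3)] by blast
  moreover have "card (insert p P) \<le> card (insert s S)"
    using P insert.hyps by (simp add: card_insert_if)
  ultimately show ?case using P(1) by blast
qed

subsection \<open>Freiman's lemma for product sets\<close>

text \<open>Extended by 0 off the primes and taken with values in a group, so that exponent vectors
  are total functions that can be subtracted.\<close>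

definition prime_exponents :: "int \<Rightarrow> int \<Rightarrow> int" where
  "prime_exponents a p = (if prime p then int (multiplicity p a) else 0)"

lemma prime_exponents_mult:
  "a \<noteq> 0 \<Longrightarrow> b \<noteq> 0 \<Longrightarrow> prime_exponents (a * b) = prime_exponents a + prime_exponents b"
  by (auto simp: prime_exponents_def fun_eq_iff prime_elem_multiplicity_mult_distrib)

lemma prime_exponents_inject:
  assumes "prime_exponents a = prime_exponents b" "a > 0" "b > 0"
  shows "a = b"
proof (rule multiplicity_eq_int)
  fix p :: int assume "prime p"
  then show "multiplicity p a = multiplicity p b"
    using fun_cong[OF assms(1), of p] by (simp add: prime_exponents_def)
qed (use assms in auto)

text \<open>Written additively, the multiplicative group generated by the ratios of elements of
  \<open>A\<close>.\<close>

definition ratio_group :: "int set \<Rightarrow> (int \<Rightarrow> int) set" where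
  "ratio_group A = group_closure {prime_exponents a - prime_exponents b | a b. a \<in> A \<and> b \<in> A}"

lemma ratio_group_mono: "A \<subseteq> B \<Longrightarrow> ratio_group A \<subseteq> ratio_group B"
  unfolding ratio_group_def by (rule group_closure_least) (auto intro!: group_closure.base)

lemma ratio_group_memI:
  "a \<in> A \<Longrightarrow> b \<in> A \<Longrightarrow> prime_exponents a - prime_exponents b \<in> ratio_group A"
  unfolding ratio_group_def by (auto intro!: group_closure.base)

text \<open>Ratios over a fixed denominator \<open>a\<close> generate all others, since b/c =
  (b/a)/(c/a).\<close>

lemma ratio_group_subset:
  assumes "\<And>b. b \<in> A \<Longrightarrow> prime_exponents b - prime_exponents a \<in> group_closure T"
  shows "ratio_group A \<subseteq> group_closure T"
  unfolding ratio_group_def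
proof (intro group_closure_least subsetI)
  fix x assume "x \<in> {prime_exponents a - prime_exponents b | a b. a \<in> A \<and> b \<in> A}"
  then obtain b c where "b \<in> A" "c \<in> A" "x = prime_exponents b - prime_exponents c" by blast
  then have x: "x = (prime_exponents b - prime_exponents a) - (prime_exponents c - prime_exponents a)"
    by simp
  show "x \<in> group_closure T"
    unfolding x using assms \<open>b \<in> A\<close> \<open>c \<in> A\<close>
    by (intro group_closure.diff[where s = "prime_exponents b - prime_exponents a"]) auto
qed

section \<open>Multiplicative dimension\<close>

text \<open>
  This is the dimension of the affine span of the exponent vectors of \<open>A\<close>, expressed without
  linear algebra as a minimal number of coordinates.
\<close>
definition mult_dim :: "int set \<Rightarrow> nat" where
  "mult_dim A = (LEAST n. \<exists>P. finite P \<and> card P = n \<and> determining P (ratio_group A))"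

lemma mult_dim_le: "finite P \<Longrightarrow> determining P (ratio_group A) \<Longrightarrow> mult_dim A \<le> card P"
  unfolding mult_dim_def by (rule Least_le) blast

lemma mult_dim_attained:
  assumes "finite A"
  obtains P where "finite P" "card P = mult_dim A" "determining P (ratio_group A)"
proof -
  have "{prime_exponents a - prime_exponents b | a b. a \<in> A \<and> b \<in> A} =
      (\<lambda>(a, b). prime_exponents a - prime_exponents b) ` (A \<times> A)"
    by auto
  then have "finite {prime_exponents a - prime_exponents b | a b. a \<in> A \<and> b \<in> A}"
    using assms by simp
  then have "\<exists>n P. finite P \<and> card P = n \<and> determining P (ratio_group A)"
    unfolding ratio_group_def using determining_exists by blast
  then have "\<exists>P. finite P \<and> card P = mult_dim A \<and> determining P (ratio_group A)"
    unfolding mult_dim_def by (rule LeastI_ex)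
  then show ?thesis using that by blast
qed

lemma mult_dim_mono:
  assumes "finite B" "A \<subseteq> B"
  shows "mult_dim A \<le> mult_dim B"
proof -
  obtain P where "finite P" "card P = mult_dim B" "determining P (ratio_group B)"
    using mult_dim_attained[OF assms(1)] .
  then show ?thesis
    using mult_dim_le[OF _ determining_antimono[OF _ ratio_group_mono[OF assms(2)]]] by metis
qed

text \<open>Over a base point \<open>c\<close> in \<open>A\<close> the only new generator is a/c,
  and one generator costs at most one coordinate.\<close>

lemma mult_dim_insert_le:
  assumes "finite A"
  shows "mult_dim (insert a A) \<le> Suc (mult_dim A)"
proof (cases "A = {}")
  case True
  have "ratio_group {a} \<subseteq> group_closure {}"
    by (rule ratio_group_subset[of _ a]) simp
  then have "determining {} (ratio_group {a})" by (auto simp: determining_def)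
  then have "mult_dim {a} \<le> 0" using mult_dim_le[of "{}" "{a}"] by simp
  then show ?thesis using True by simp
next
  case False
  then obtain c where c: "c \<in> A" by blast
  obtain P where P: "finite P" "card P = mult_dim A" "determining P (ratio_group A)"
    using mult_dim_attained[OF assms] .
  let ?S = "{prime_exponents a - prime_exponents b | a b. a \<in> A \<and> b \<in> A}"
  let ?s = "prime_exponents a - prime_exponents c"
  obtain p where p: "determining (insert p P) (group_closure (insert ?s ?S))"
    using determining_insert P(3) unfolding ratio_group_def by blast
  have "ratio_group (insert a A) \<subseteq> group_closure (insert ?s ?S)"
    by (rule ratio_group_subset[of _ c]) (use c in \<open>auto intro!: group_closure.base\<close>)
  then have "mult_dim (insert a A) \<le> card (insert p P)"
    using p P(1) by (intro mult_dim_le) (auto intro: determining_antimono)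
  also have "\<dots> \<le> Suc (mult_dim A)" using P by (simp add: card_insert_if)
  finally show ?thesis .
qed

section \<open>Growth of the product set with the dimension\<close>

lemma finite_product_set: "finite A \<Longrightarrow> finite (product_set A)"
proof -
  assume "finite A"
  moreover have "product_set A = (\<lambda>(a, b). a * b) ` (A \<times> A)" unfolding product_set_def by auto
  ultimately show ?thesis by simp
qed

text \<open>From a b = x y follows a/x = y/b, so the ratio of \<open>a\<close> to \<open>x\<close>
  is already a ratio of elements of \<open>A\<close> and no new direction appears.\<close>

lemma mult_dim_insert_eq:
  assumes A: "finite A" "\<And>b. b \<in> insert a A \<Longrightarrow> b > 0"
    and b: "b \<in> A" and ab: "a * b \<in> product_set A"
  shows "mult_dim (insert a A) \<le> mult_dim A"
proof -
  obtain x y where xy: "x \<in> A" "y \<in> A" "a * b = x * y" using ab unfolding product_set_def by blast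
  then have "prime_exponents a + prime_exponents b = prime_exponents x + prime_exponents y"
    using A(2)[of a] A(2)[of b] A(2)[of x] A(2)[of y] b
      prime_exponents_mult[of a b] prime_exponents_mult[of x y] by simp
  then have eq: "prime_exponents a - prime_exponents x = prime_exponents y - prime_exponents b"
    by (simp add: algebra_simps)
  have "prime_exponents c - prime_exponents x \<in> ratio_group A" if "c \<in> insert a A" for c
  proof (cases "c = a")
    case True
    then show ?thesis unfolding True eq by (intro ratio_group_memI xy b)
  next
    case False
    then show ?thesis using that xy by (intro ratio_group_memI) auto
  qed
  then have sub: "ratio_group (insert a A) \<subseteq> ratio_group A"
    unfolding ratio_group_def[of A] by (rule ratio_group_subset)
  obtain P where "finite P" "card P = mult_dim A" "determining P (ratio_group A)"
    using mult_dim_attained[OF A(1)] .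
  then show ?thesis using mult_dim_le[OF _ determining_antimono[OF _ sub]] by metis
qed

text \<open>
  The set \<open>I\<close> consists of the irreducibles: the ratios \<open>b / a\<close> with \<open>b \<in> A - {a}\<close> all exceed
  \<open>1\<close>, so splitting a ratio into a product of two ratios terminates, and every ratio is a
  product of ratios coming from \<open>I\<close>.
\<close>
lemma product_set_remove_min:
  fixes A :: "int set"
  assumes A: "finite A" "A \<noteq> {}" "\<And>b. b \<in> A \<Longrightarrow> b > 0"
  defines "a \<equiv> Min A"
  defines "I \<equiv> {b \<in> A - {a}. a * b \<notin> product_set (A - {a})}"
  shows "card (product_set A) \<ge> card (product_set (A - {a})) + card I + 1"
    and "mult_dim A \<le> card I"
proof -
  have a: "a \<in> A" "a > 0" and less: "\<And>b. b \<in> A - {a} \<Longrightarrow> a < b"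
    using A unfolding a_def by (auto simp: order.strict_iff_order)
  have fin: "finite I" using A unfolding I_def by simp
  have "a * a \<notin> product_set (A - {a})"
  proof
    assume "a * a \<in> product_set (A - {a})"
    then obtain x y where "x \<in> A - {a}" "y \<in> A - {a}" "a * a = x * y"
      unfolding product_set_def by blast
    moreover from this have "a * a < x * y"
      using less[of x] less[of y] a by (intro mult_strict_mono) auto
    ultimately show False by simp
  qed
  then have disj: "product_set (A - {a}) \<inter> (*) a ` insert a I = {}"
    unfolding I_def by auto
  \<comment> \<open>The products of \<open>a\<close> with itself and with the elements of
    \<open>I\<close> are \<open>card I + 1\<close> elements that are lost on passing to
    \<open>A - {a}\<close>.\<close>
  have "card (product_set (A - {a})) + card I + 1 =
      card (product_set (A - {a})) + card ((*) a ` insert a I)"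
    using a fin by (subst card_image) (auto simp: inj_on_def I_def)
  also have "\<dots> = card (product_set (A - {a}) \<union> (*) a ` insert a I)"
    using disj fin A by (subst card_Un_disjoint) (auto intro: finite_product_set)
  also have "\<dots> \<le> card (product_set A)"
    using A a by (intro card_mono finite_product_set) (auto simp: product_set_def I_def)
  finally show "card (product_set A) \<ge> card (product_set (A - {a})) + card I + 1" .
  define T where "T = (\<lambda>b. prime_exponents b - prime_exponents a) ` I"
  have gen: "prime_exponents b - prime_exponents a \<in> group_closure T" if "b \<in> A" for b
    using that
  proof (induction "nat b" arbitrary: b rule: less_induct)
    case less
    consider "b = a" | "b \<in> I" | "b \<in> A - {a}" "a * b \<in> product_set (A - {a})"
      using less.prems unfolding I_def by blast
    then show ?case
    proof cases
      case 3
      then obtain x y where xy: "x \<in> A - {a}" "y \<in> A - {a}" "a * b = x * y"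
        unfolding product_set_def by blast
      have gt: "a < x" "a < y" using xy \<open>\<And>b. b \<in> A - {a} \<Longrightarrow> a < b\<close> by auto
      have b0: "b > 0" using less.prems A by simp
      \<comment> \<open>As \<open>x\<close> and \<open>y\<close> both exceed \<open>a\<close>, the
        equation a b = x y forces both to be smaller than \<open>b\<close>; this is the
        descent.\<close>
      have "x < b"
      proof (rule ccontr)
        assume "\<not> x < b"
        then have "a * b < x * y" using gt a b0
          by (subst mult.commute, intro mult_le_less_imp_less) auto
        then show False using xy by simp
      qed
      moreover have "y < b"
      proof (rule ccontr)
        assume "\<not> y < b"
        then have "a * b < x * y" using gt a b0
          by (intro mult_less_le_imp_less) auto
        then show False using xy by simp
      qed
      ultimately have T: "prime_exponents x - prime_exponents a \<in> group_closure T"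
        "prime_exponents y - prime_exponents a \<in> group_closure T"
        using less.hyps[of x] less.hyps[of y] xy b0 by auto
      have "prime_exponents a + prime_exponents b = prime_exponents x + prime_exponents y"
        using prime_exponents_mult[of a b] prime_exponents_mult[of x y] xy(3) gt a b0 by simp
      then have eq: "prime_exponents b - prime_exponents a =
          (prime_exponents x - prime_exponents a) + (prime_exponents y - prime_exponents a)"
        by (simp add: algebra_simps)
      show ?thesis unfolding eq using T by (rule group_closure_add)
    qed (auto simp: T_def intro!: group_closure.base)
  qed
  obtain P where P: "finite P" "card P \<le> card T" "determining P (group_closure T)"
    using determining_exists[of T] fin T_def by blast
  have "determining P (ratio_group A)"
    using P(3) ratio_group_subset[of A a T] gen determining_antimono by blast
  then have "mult_dim A \<le> card P" using P(1) mult_dim_le by blast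
  also have "\<dots> \<le> card I" using P(2) card_image_le[OF fin] unfolding T_def by (rule le_trans)
  finally show "mult_dim A \<le> card I" .
qed

lemma mult_dim_less_card:
  assumes A: "finite A" "A \<noteq> {}" "\<And>b. b \<in> A \<Longrightarrow> b > 0"
  shows "mult_dim A < card A"
proof -
  have "mult_dim A \<le> card {b \<in> A - {Min A}. Min A * b \<notin> product_set (A - {Min A})}"
    using product_set_remove_min(2)[OF A] .
  also have "\<dots> \<le> card (A - {Min A})" using A(1) by (intro card_mono) auto
  also have "\<dots> < card A" using A Min_in[OF A(1,2)] by (intro card_Diff1_less)
  finally show ?thesis .
qed

text \<open>This is |AA| >= (d + 1) |A| - d (d + 1) / 2, rearranged to stay in \<open>nat\<close>.
  Removing the minimum loses at least d + 1 products if the dimension stays d. If it drops, no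
  product of the minimum with another element can be recovered, so all \<open>card A\<close>
  products with the minimum are lost.\<close>

lemma freiman_product_set:
  assumes "finite A" "\<And>b. b \<in> A \<Longrightarrow> b > 0"
  shows "2 * card (product_set A) + mult_dim A * (mult_dim A + 1) \<ge> 2 * (mult_dim A + 1) * card A"
  using assms
proof (induction "card A" arbitrary: A)
  case 0
  then show ?case by simp
next
  case (Suc n)
  define a where "a = Min A"
  define B where "B = A - {a}"
  have ne: "A \<noteq> {}" using Suc.hyps(2) by auto
  have a: "a \<in> A" "a > 0" using Suc.prems ne unfolding a_def by auto
  have AB: "A = insert a B" "a \<notin> B" using a unfolding B_def by auto
  have B: "finite B" "\<And>b. b \<in> B \<Longrightarrow> b > 0" "card B = n"
    using Suc.prems Suc.hyps(2) a unfolding B_def by auto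
  have IH: "2 * card (product_set B) + mult_dim B * (mult_dim B + 1) \<ge> 2 * (mult_dim B + 1) * n"
    using Suc.hyps(1)[of B] B by auto
  have le: "mult_dim B \<le> mult_dim A" "mult_dim A \<le> Suc (mult_dim B)"
    using mult_dim_mono[OF Suc.prems(1), of B] mult_dim_insert_le[OF B(1), of a]
    unfolding AB(1)[symmetric] by (auto simp: B_def)
  show ?case
  proof (cases "mult_dim A = mult_dim B")
    case True
    have "card (product_set A) \<ge> card (product_set B) + mult_dim A + 1"
      using product_set_remove_min[OF Suc.prems(1) ne Suc.prems(2), folded a_def, folded B_def]
      by linarith
    then show ?thesis using IH True Suc.hyps(2)[symmetric] by (simp add: algebra_simps)
  next
    case False
    then have d: "mult_dim A = Suc (mult_dim B)" using le by simp
    have "a * b \<notin> product_set B" if "b \<in> B" for b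
    proof
      assume "a * b \<in> product_set B"
      then have "mult_dim (insert a B) \<le> mult_dim B"
        using B(1) that Suc.prems(2) unfolding AB(1) by (intro mult_dim_insert_eq) auto
      then show False using d unfolding AB(1)[symmetric] by simp
    qed
    then have eq: "{b \<in> B. a * b \<notin> product_set B} = B"
      by auto
    have "card (product_set A) \<ge> card (product_set B) + n + 1"
      using product_set_remove_min(1)[OF Suc.prems(1) ne Suc.prems(2), folded a_def, folded B_def]
      unfolding eq B(3) by blast
    then show ?thesis using IH d Suc.hyps(2)[symmetric] by (simp add: algebra_simps)
  qed
qed

text \<open>Suppose d >= K. The trivial bound d + 1 <= |A| makes the quadratic error in Freiman's
  inequality linear in |A| and gives d + 2 <= 2 K; the same inequality then yields 2 |A| <= d (d +
  1) <= 4 K^2, against \<open>large\<close>.\<close>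

lemma mult_dim_less_doubling:
  fixes K :: int
  assumes A: "finite A" "\<And>b. b \<in> A \<Longrightarrow> b > 0"
    and dbl: "int (card (product_set A)) \<le> K * int (card A)"
    and large: "2 * K\<^sup>2 < int (card A)"
  shows "int (mult_dim A) < K"
proof (rule ccontr)
  assume less: "\<not> int (mult_dim A) < K"
  define d n where "d = int (mult_dim A)" and "n = int (card A)"
  have n: "n > 0" using large zero_le_power2[of K] unfolding n_def by linarith
  then have "A \<noteq> {}" unfolding n_def by auto
  then have dn: "d + 1 \<le> n" using mult_dim_less_card[OF A(1) _ A(2)] unfolding d_def n_def by simp
  have "2 * int (card (product_set A)) + d * (d + 1) \<ge> 2 * (d + 1) * n"
    using iffD2[OF zle_int freiman_product_set[OF A]] unfolding d_def n_def by (simp add: algebra_simps)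
  then have F: "2 * (d + 1) * n \<le> 2 * K * n + d * (d + 1)" using dbl unfolding n_def by linarith
  have dK: "d \<ge> K" "d \<ge> 0" using less unfolding d_def by auto
  have "d * (d + 1) \<le> d * n" using dn dK by (intro mult_left_mono) auto
  then have "(2 * (d + 1)) * n \<le> (2 * K + d) * n" using F by (simp add: algebra_simps)
  then have d2: "d + 2 \<le> 2 * K" using n by simp
  have "2 * K * n \<le> 2 * d * n" using n dK by (intro mult_right_mono) auto
  then have "2 * n \<le> d * (d + 1)" using F by (simp add: algebra_simps)
  also have "\<dots> \<le> (2 * K) * (2 * K)" using d2 dK by (intro mult_mono) auto
  finally show False using large unfolding n_def by (simp add: power2_eq_square)
qed

subsection \<open>Fourier expansion of multiplicative energies\<close>

lemma cis_eq_1_iff: "cis (2 * pi * x) = 1 \<longleftrightarrow> x \<in> \<int>"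
proof
  assume "cis (2 * pi * x) = 1"
  then obtain n :: int where "2 * pi * x = of_int (2 * n) * pi"
    unfolding cis_conv_exp exp_eq_1 by auto
  then have "x = of_int n" by simp
  then show "x \<in> \<int>" by simp
qed simp

lemma sum_cis_orthogonality:
  fixes Q m n :: nat
  assumes "Q > 0"
  shows "(\<Sum>z<Q. cis (2 * pi * real z * (real m - real n) / real Q)) =
    (if [m = n] (mod Q) then of_nat Q else 0)"
proof -
  define x where "x = (real m - real n) / real Q"
  have pw: "cis (2 * pi * real z * (real m - real n) / real Q) = cis (2 * pi * x) ^ z" for z
    by (subst Complex.DeMoivre, rule arg_cong[of _ _ cis]) (simp add: x_def field_simps)
  have "[m = n] (mod Q) \<longleftrightarrow> x \<in> \<int>"
  proof
    assume "[m = n] (mod Q)"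
    then have "int Q dvd int m - int n" by (metis cong_iff_dvd_diff cong_int_iff)
    then obtain c where "int m - int n = int Q * c" by blast
    then have "real m - real n = real Q * of_int c"
      by (metis of_int_diff of_int_mult of_int_of_nat_eq)
    then have "x = of_int c" using assms by (simp add: x_def)
    then show "x \<in> \<int>" by simp
  next
    assume "x \<in> \<int>"
    then obtain c where "x = of_int c" by (auto elim: Ints_cases)
    then have "of_int (int m - int n) = (of_int (int Q * c) :: real)"
      using assms by (simp add: x_def field_simps)
    then have "int Q dvd int m - int n" by (metis dvd_triv_left of_int_eq_iff)
    then show "[m = n] (mod Q)" by (metis cong_iff_dvd_diff cong_int_iff)
  qed
  then have iff: "[m = n] (mod Q) \<longleftrightarrow> cis (2 * pi * x) = 1" by (simp add: cis_eq_1_iff)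
  have "cis (2 * pi * x) ^ Q = 1"
  proof -
    have "cis (2 * pi * x) ^ Q = cis (2 * pi * of_int (int m - int n))"
      by (subst Complex.DeMoivre, rule arg_cong[of _ _ cis]) (use assms in \<open>simp add: x_def field_simps\<close>)
    also have "\<dots> = 1" unfolding cis_eq_1_iff by (rule Ints_of_int)
    finally show ?thesis .
  qed
  then show ?thesis
    unfolding pw iff using geometric_sum[of "cis (2 * pi * x)" Q]
    by (cases "cis (2 * pi * x) = 1") simp_all
qed

text \<open>The multiplicative equation becomes additive modulo \<open>Q\<close>, which makes finite
  Fourier analysis available; \<open>\<phi>\<close> is a discrete logarithm.\<close>

lemma multiplicative_embedding:
  fixes B :: "int set" and k :: nat
  assumes B: "finite B" "0 \<notin> B"
  obtains Q :: nat and \<phi> :: "int \<Rightarrow> nat" where "Q > 0"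
    "\<forall>b\<in>{..<2*k} \<rightarrow> B. (\<Prod>i<k. b i) = (\<Prod>i=k..<2*k. b i) \<longleftrightarrow>
       [(\<Sum>i<k. \<phi> (b i)) = (\<Sum>i=k..<2*k. \<phi> (b i))] (mod Q)"
proof -
  define C where "C = Max (insert 1 (abs ` B))"
  have C: "C \<ge> 1" "\<And>b. b \<in> B \<Longrightarrow> \<bar>b\<bar> \<le> C" using B unfolding C_def by auto
  \<comment> \<open>Modulo a large prime no two distinct products collide, and discrete logarithms to the base
      of a primitive root make the equation additive, negative factors included.\<close>
  obtain q :: nat where q: "prime q" "q > nat (2 * C ^ k + C)" using bigger_prime by blast
  \<comment> \<open>The term \<open>2 * C ^ k\<close> bounds the difference of two products; the
    summand \<open>C\<close> keeps the elements of \<open>B\<close> nonzero modulo \<open>q\<close>,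
    also for \<open>k = 0\<close>.\<close>
  have qC: "int q > 2 * C ^ k + C" using q(2) by linarith
  have Ck: "C ^ k \<ge> 1" using C(1) by (rule one_le_power)
  have q1: "q > 1" using q(1) prime_gt_1_nat by blast
  obtain g where g: "residue_primroot q g" using prime_primitive_root_exists[OF q1 q(1)] by blast
  have "\<exists>i. [int g ^ i = b] (mod int q)" if "b \<in> B" for b
  proof -
    have "\<not> int q dvd b"
    proof
      assume "int q dvd b"
      moreover have "b \<noteq> 0" using that B by auto
      ultimately have "int q \<le> \<bar>b\<bar>" using dvd_imp_le_int[of b "int q"] by simp
      then show False using C(2)[OF that] qC Ck by linarith
    qed
    then have "\<not> int q dvd b mod int q" by (simp add: dvd_mod_iff)
    then have nd: "\<not> q dvd nat (b mod int q)"
      using q1 by (simp add: int_dvd_int_iff[symmetric])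
    then have "coprime (nat (b mod int q)) q"
      using q(1) prime_imp_coprime coprime_commute by blast
    moreover have "nat (b mod int q) \<le> q"
      using q1 by (simp add: nat_le_iff order_less_imp_le)
    moreover have "nat (b mod int q) > 0" using nd by (intro gr0I) auto
    ultimately have "nat (b mod int q) \<in> totatives q" by (simp add: in_totatives_iff)
    then obtain i where "g ^ i mod q = nat (b mod int q)"
      using residue_primroot_is_generator[OF q1 g] unfolding bij_betw_def by force
    then have "int (g ^ i mod q) = b mod int q" using q1 by simp
    then have "int g ^ i mod int q = b mod int q" by (simp add: zmod_int)
    then show ?thesis unfolding cong_def by blast
  qed
  then obtain \<phi> where \<phi>: "\<And>b. b \<in> B \<Longrightarrow> [int g ^ \<phi> b = b] (mod int q)" by metis
  show ?thesis
  proof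
    \<comment> \<open>Exponents of the primitive root matter only modulo its order, which is
      \<open>totient q\<close>.\<close>
    show "totient q > 0" using q1 by simp
    show "\<forall>b\<in>{..<2*k} \<rightarrow> B. (\<Prod>i<k. b i) = (\<Prod>i=k..<2*k. b i) \<longleftrightarrow>
       [(\<Sum>i<k. \<phi> (b i)) = (\<Sum>i=k..<2*k. \<phi> (b i))] (mod totient q)"
    proof
      fix b :: "nat \<Rightarrow> int" assume b: "b \<in> {..<2*k} \<rightarrow> B"
      have bound: "\<bar>\<Prod>i\<in>I. b i\<bar> \<le> C ^ k" if "I \<subseteq> {..<2*k}" "card I = k" for I
      proof -
        have "\<bar>\<Prod>i\<in>I. b i\<bar> = (\<Prod>i\<in>I. \<bar>b i\<bar>)" by (rule abs_prod)
        also have "\<dots> \<le> (\<Prod>i\<in>I. C)" using that b C(2) by (intro prod_mono) auto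
        finally show ?thesis using that by simp
      qed
      have cong: "[int g ^ (\<Sum>i\<in>I. \<phi> (b i)) = (\<Prod>i\<in>I. b i)] (mod int q)" if "I \<subseteq> {..<2*k}" for I
        unfolding power_sum using that b \<phi> by (intro cong_prod) auto
      let ?L = "\<Prod>i<k. b i" and ?R = "\<Prod>i=k..<2*k. b i"
      have "?L = ?R \<longleftrightarrow> [?L = ?R] (mod int q)"
      proof
        assume "[?L = ?R] (mod int q)"
        then have "int q dvd ?L - ?R" by (simp add: cong_iff_dvd_diff)
        moreover have "\<bar>?L\<bar> \<le> C ^ k" "\<bar>?R\<bar> \<le> C ^ k"
          by (intro bound; auto)+
        then have "\<bar>?L - ?R\<bar> < int q" using qC C(1) by linarith
        ultimately show "?L = ?R" using dvd_imp_le_int[of "?L - ?R" "int q"] by linarith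
      qed simp
      also have "\<dots> \<longleftrightarrow> [int g ^ (\<Sum>i<k. \<phi> (b i)) = int g ^ (\<Sum>i=k..<2*k. \<phi> (b i))] (mod int q)"
      proof -
        have "[int g ^ (\<Sum>i<k. \<phi> (b i)) = ?L] (mod int q)"
          "[int g ^ (\<Sum>i=k..<2*k. \<phi> (b i)) = ?R] (mod int q)"
          by (intro cong; auto)+
        then show ?thesis unfolding cong_def by argo
      qed
      also have "\<dots> \<longleftrightarrow> [g ^ (\<Sum>i<k. \<phi> (b i)) = g ^ (\<Sum>i=k..<2*k. \<phi> (b i))] (mod q)"
        unfolding of_nat_power[symmetric] cong_int_iff ..
      also have "\<dots> \<longleftrightarrow> [(\<Sum>i<k. \<phi> (b i)) = (\<Sum>i=k..<2*k. \<phi> (b i))] (mod totient q)"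
        using g order_divides_expdiff[of q g] by (simp add: residue_primroot_def)
      finally show "?L = ?R \<longleftrightarrow> [(\<Sum>i<k. \<phi> (b i)) = (\<Sum>i=k..<2*k. \<phi> (b i))] (mod totient q)" .
    qed
  qed
qed

definition multiplicative_solutions :: "nat \<Rightarrow> 'a::comm_monoid_mult set \<Rightarrow> (nat \<Rightarrow> 'a) set" where
  "multiplicative_solutions k B =
     {b \<in> {..<2*k} \<rightarrow>\<^sub>E B. (\<Prod>i<k. b i) = (\<Prod>i=k..<2*k. b i)}"

lemma finite_multiplicative_solutions: "finite B \<Longrightarrow> finite (multiplicative_solutions k B)"
  unfolding multiplicative_solutions_def
  by (rule finite_subset[OF _ finite_PiE[of "{..<2*k}" "\<lambda>_. B"]]) auto

lemma weighted_energy_eq_sum_solutions: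
  "weighted_energy k w B = (\<Sum>b\<in>multiplicative_solutions k B. \<Prod>i<2*k. w (b i))"
  unfolding weighted_energy_def multiplicative_solutions_def ..

lemma cis_sum: "cis (\<Sum>i\<in>I. f i) = (\<Prod>i\<in>I. cis (f i))"
  by (induction I rule: infinite_finite_induct) (auto simp flip: cis_mult)

text \<open>Each position carries its own weight function because the colouring argument changes the
  weight at two positions only. \<open>F\<close> is the Fourier transform along the discrete
  logarithm; factors on the right of the equation appear conjugated.\<close>

lemma solutions_fourier:
  fixes B :: "int set" and k :: nat
  assumes B: "finite B" "0 \<notin> B"
  obtains Q :: nat and F :: "(int \<Rightarrow> real) \<Rightarrow> nat \<Rightarrow> complex" where "Q > 0"
    "\<forall>g. complex_of_real (\<Sum>b\<in>multiplicative_solutions k B. \<Prod>i<2*k. g i (b i)) =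
       (\<Sum>z<Q. \<Prod>i<2*k. if i < k then F (g i) z else cnj (F (g i) z)) / of_nat Q"
proof -
  obtain Q :: nat and \<phi> where Q: "Q > 0" and \<phi>:
    "\<forall>b\<in>{..<2*k} \<rightarrow> B. (\<Prod>i<k. b i) = (\<Prod>i=k..<2*k. b i) \<longleftrightarrow>
       [(\<Sum>i<k. \<phi> (b i)) = (\<Sum>i=k..<2*k. \<phi> (b i))] (mod Q)"
    using multiplicative_embedding[OF B, where k = k] .
  define F where "F g z = (\<Sum>b\<in>B. complex_of_real (g b) * cis (2 * pi * real z * real (\<phi> b) / real Q))"
    for g :: "int \<Rightarrow> real" and z :: nat
  define \<epsilon> :: "nat \<Rightarrow> real" where "\<epsilon> i = (if i < k then 1 else -1)" for i
  show ?thesis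
  proof
    show "Q > 0" by fact
    show "\<forall>g. complex_of_real (\<Sum>b\<in>multiplicative_solutions k B. \<Prod>i<2*k. g i (b i)) =
       (\<Sum>z<Q. \<Prod>i<2*k. if i < k then F (g i) z else cnj (F (g i) z)) / of_nat Q"
    proof
      fix g :: "nat \<Rightarrow> int \<Rightarrow> real"
      have F: "(if i < k then F (g i) z else cnj (F (g i) z)) =
        (\<Sum>b\<in>B. complex_of_real (g i b) * cis (\<epsilon> i * (2 * pi * real z * real (\<phi> b) / real Q)))" for i z
        by (simp add: F_def \<epsilon>_def cis_cnj)
      have exponent: "(\<Sum>i<2*k. \<epsilon> i * (2 * pi * real z * real (\<phi> (b i)) / real Q)) =
          2 * pi * real z * (real (\<Sum>i<k. \<phi> (b i)) - real (\<Sum>i=k..<2*k. \<phi> (b i))) / real Q" for b z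
      proof -
        have split: "{..<2*k} = {..<k} \<union> {k..<2*k}" by auto
        have "(\<Sum>i<2*k. \<epsilon> i * (2 * pi * real z * real (\<phi> (b i)) / real Q)) =
            (\<Sum>i<k. \<epsilon> i * (2 * pi * real z * real (\<phi> (b i)) / real Q)) +
            (\<Sum>i=k..<2*k. \<epsilon> i * (2 * pi * real z * real (\<phi> (b i)) / real Q))"
          unfolding split by (rule sum.union_disjoint) auto
        also have "(\<Sum>i<k. \<epsilon> i * (2 * pi * real z * real (\<phi> (b i)) / real Q)) =
            2 * pi * real z / real Q * (\<Sum>i<k. real (\<phi> (b i)))"
          unfolding sum_distrib_left by (intro sum.cong) (auto simp: \<epsilon>_def)
        also have "(\<Sum>i=k..<2*k. \<epsilon> i * (2 * pi * real z * real (\<phi> (b i)) / real Q)) =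
            - (2 * pi * real z / real Q * (\<Sum>i=k..<2*k. real (\<phi> (b i))))"
          unfolding sum_distrib_left sum_negf[symmetric] by (intro sum.cong) (auto simp: \<epsilon>_def)
        finally show ?thesis by (simp add: right_diff_distrib diff_divide_distrib)
      qed
      have "(\<Sum>z<Q. \<Prod>i<2*k. if i < k then F (g i) z else cnj (F (g i) z)) =
          (\<Sum>z<Q. \<Sum>b\<in>{..<2*k} \<rightarrow>\<^sub>E B. \<Prod>i<2*k.
             complex_of_real (g i (b i)) * cis (\<epsilon> i * (2 * pi * real z * real (\<phi> (b i)) / real Q)))"
        unfolding F using B by (subst prod_sum_PiE) auto
      \<comment> \<open>Interchanging the sums leaves for each tuple a character sum over
        \<open>z\<close>, which detects the congruence.\<close>
      also have "\<dots> = (\<Sum>b\<in>{..<2*k} \<rightarrow>\<^sub>E B. \<Sum>z<Q. complex_of_real (\<Prod>i<2*k. g i (b i)) *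
          cis (2 * pi * real z * (real (\<Sum>i<k. \<phi> (b i)) - real (\<Sum>i=k..<2*k. \<phi> (b i))) / real Q))"
        unfolding prod.distrib cis_sum[symmetric] exponent of_real_prod by (rule sum.swap)
      also have "\<dots> = (\<Sum>b\<in>{..<2*k} \<rightarrow>\<^sub>E B. complex_of_real (\<Prod>i<2*k. g i (b i)) *
          (if [(\<Sum>i<k. \<phi> (b i)) = (\<Sum>i=k..<2*k. \<phi> (b i))] (mod Q) then of_nat Q else 0))"
        unfolding sum_distrib_left[symmetric] sum_cis_orthogonality[OF Q] ..
      also have "\<dots> = (\<Sum>b\<in>{..<2*k} \<rightarrow>\<^sub>E B. if (\<Prod>i<k. b i) = (\<Prod>i=k..<2*k. b i)
          then complex_of_real (\<Prod>i<2*k. g i (b i)) * of_nat Q else 0)"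
        by (intro sum.cong refl) (use \<phi> in \<open>auto simp: PiE_iff Pi_iff\<close>)
      also have "\<dots> = (\<Sum>b\<in>multiplicative_solutions k B. complex_of_real (\<Prod>i<2*k. g i (b i)) * of_nat Q)"
        unfolding multiplicative_solutions_def using B(1) by (intro sum.inter_filter[symmetric] finite_PiE) auto
      finally show "complex_of_real (\<Sum>b\<in>multiplicative_solutions k B. \<Prod>i<2*k. g i (b i)) =
         (\<Sum>z<Q. \<Prod>i<2*k. if i < k then F (g i) z else cnj (F (g i) z)) / of_nat Q"
        using Q by (simp add: sum_distrib_right[symmetric])
    qed
  qed
qed

subsection \<open>Energy of coloured sets\<close>

text \<open>Young's inequality for the exponents k and k / (k - 1), cleared of denominators; it is
  Bernoulli's inequality for \<open>(a / b) ^ k\<close>.\<close>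

lemma young_power:
  fixes a b :: real
  assumes "a \<ge> 0" "b \<ge> 0" "k \<ge> 1"
  shows "real k * (a * b ^ (k - 1)) \<le> a ^ k + (real k - 1) * b ^ k"
proof (cases "b = 0")
  case True
  then show ?thesis using assms by (cases "k = 1") (auto simp: power_0_left)
next
  case False
  then have b: "b > 0" using assms by simp
  have "1 + real k * (a / b - 1) \<le> (1 + (a / b - 1)) ^ k"
    using assms b by (intro Bernoulli_inequality) simp
  then have "(1 + real k * (a / b - 1)) * b ^ k \<le> (a / b) ^ k * b ^ k"
    using b by (intro mult_right_mono) auto
  also have "(a / b) ^ k * b ^ k = a ^ k" using b by (simp add: power_divide)
  also have "(1 + real k * (a / b - 1)) * b ^ k = b ^ k + real k * (a * b ^ (k - 1)) - real k * b ^ k"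
    using assms b by (cases k) (auto simp: field_simps)
  finally show ?thesis by (simp add: algebra_simps)
qed

text \<open>Hoelder's inequality for the exponents k and k / (k - 1), obtained by summing Young's
  inequality for \<open>X z / s\<close> and \<open>Y z / D\<close>. Bounds given as k-th powers
  avoid roots; \<open>s = 0\<close> is separate because of the division.\<close>

lemma holder_sum_power:
  fixes X Y :: "nat \<Rightarrow> real"
  assumes k: "k \<ge> 1" and X: "\<And>z. 0 \<le> X z" and Y: "\<And>z. 0 \<le> Y z"
    and s: "0 \<le> s" and D: "0 < D" and q: "0 \<le> q"
    and sX: "(\<Sum>z<Q. X z ^ k) \<le> q * s ^ k" and sY: "(\<Sum>z<Q. Y z ^ k) \<le> q * D ^ k"
  shows "(\<Sum>z<Q. X z * Y z ^ (k - 1)) \<le> q * (s * D ^ (k - 1))"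
proof (cases "s = 0")
  case True
  then have "(\<Sum>z<Q. X z ^ k) = 0"
    using sX k X by (intro order_antisym sum_nonneg) (auto simp: power_0_left)
  then have "X z = 0" if "z < Q" for z
    using that X k by (subst (asm) sum_nonneg_eq_0_iff) auto
  then show ?thesis using True by simp
next
  case False
  then have s: "s > 0" using s by simp
  have "real k * (X z * Y z ^ (k - 1)) \<le> s * D ^ (k - 1) * (X z ^ k / s ^ k + (real k - 1) * (Y z ^ k / D ^ k))" for z
  proof -
    have "real k * ((X z / s) * (Y z / D) ^ (k - 1)) \<le> (X z / s) ^ k + (real k - 1) * (Y z / D) ^ k"
      using X Y s D k by (intro young_power) auto
    then have "s * D ^ (k - 1) * (real k * ((X z / s) * (Y z / D) ^ (k - 1))) \<le>
      s * D ^ (k - 1) * ((X z / s) ^ k + (real k - 1) * (Y z / D) ^ k)"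
      using s D by (intro mult_left_mono) auto
    also have "s * D ^ (k - 1) * (real k * ((X z / s) * (Y z / D) ^ (k - 1))) = real k * (X z * Y z ^ (k - 1))"
      using s D by (simp add: power_divide)
    finally show ?thesis by (simp add: power_divide)
  qed
  then have "(\<Sum>z<Q. real k * (X z * Y z ^ (k - 1))) \<le>
    (\<Sum>z<Q. s * D ^ (k - 1) * (X z ^ k / s ^ k + (real k - 1) * (Y z ^ k / D ^ k)))"
    by (rule sum_mono)
  also have "\<dots> = s * D ^ (k - 1) * ((\<Sum>z<Q. X z ^ k) / s ^ k + (real k - 1) * ((\<Sum>z<Q. Y z ^ k) / D ^ k))"
    by (simp only: sum_distrib_left[symmetric] sum_divide_distrib[symmetric] sum.distrib)
  also have "\<dots> \<le> s * D ^ (k - 1) * (q + (real k - 1) * q)"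
    using s D k sX sY by (intro mult_left_mono add_mono) (auto simp: divide_le_eq)
  finally have "real k * (\<Sum>z<Q. X z * Y z ^ (k - 1)) \<le> real k * (q * (s * D ^ (k - 1)))"
    by (simp add: sum_distrib_left algebra_simps)
  then show ?thesis using k by simp
qed

section \<open>Energy bounds from colourings\<close>

text \<open>
  By homogeneity in \<open>w\<close>, for finite nonempty \<open>B\<close>, \<open>k \<ge> 1\<close> and \<open>M \<ge> 0\<close> this says that \<open>Lambda_const k B \<le> M\<close>.
\<close>
definition energy_bounded :: "nat \<Rightarrow> 'a::comm_monoid_mult set \<Rightarrow> real \<Rightarrow> bool" where
  "energy_bounded k B M \<longleftrightarrow>
     (\<forall>w. (\<forall>b\<in>B. 0 \<le> w b) \<longrightarrow> weighted_energy k w B \<le> (M * (\<Sum>b\<in>B. (w b)\<^sup>2)) ^ k)"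

text \<open>The source of the constant 2 k^2: there are k (2 k - 1) pairs of positions.\<close>

lemma card_ordered_pairs: "real (card (SIGMA t:{..<2*k}. {..<t})) \<le> 2 * real k ^ 2"
proof -
  have "card (SIGMA t:{..<n}. {..<t}) * 2 \<le> n * n" for n :: nat
  proof (induction n)
    case (Suc n)
    have "(SIGMA t:{..<Suc n}. {..<t}) = (SIGMA t:{..<n}. {..<t}) \<union> {n} \<times> {..<n}"
      by (auto simp: less_Suc_eq)
    then have "card (SIGMA t:{..<Suc n}. {..<t}) = card (SIGMA t:{..<n}. {..<t}) + n"
      by (simp only:) (subst card_Un_disjoint; auto simp: card_cartesian_product)
    then show ?case using Suc by simp
  qed simp
  from this[of "2 * k"] have "card (SIGMA t:{..<2*k}. {..<t}) \<le> 2 * k ^ 2"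
    by (simp add: power2_eq_square)
  then have "real (card (SIGMA t:{..<2*k}. {..<t})) \<le> real (2 * k ^ 2)"
    by (simp only: of_nat_le_iff)
  then show ?thesis by simp
qed

text \<open>Each solution is charged to a pair of equally coloured positions and their colour j. The
  contribution of a pair and a colour is at most the mean of |F (W j)|^2 |F w|^(2k-2), which
  Hoelder's inequality bounds by M (S j) D^(k-1), where D^k is the whole energy. Summing over pairs
  and colours and cancelling D^(k-1) gives the claim.\<close>

lemma energy_bounded_colouring:
  fixes B :: "int set" and c :: "int \<Rightarrow> 'c"
  assumes k: "k \<ge> 1" and B: "finite B" "0 \<notin> B" and M: "M \<ge> 0"
    and col: "\<And>b. b \<in> multiplicative_solutions k B \<Longrightarrow> \<exists>s t. s < t \<and> t < 2 * k \<and> c (b s) = c (b t)"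
    and cls: "\<And>j. energy_bounded k {b \<in> B. c b = j} M"
  shows "energy_bounded k B (2 * real k ^ 2 * M)"
  unfolding energy_bounded_def
proof (intro allI impI)
  fix w :: "int \<Rightarrow> real" assume w: "\<forall>b\<in>B. 0 \<le> w b"
  let ?Sol = "multiplicative_solutions k B"
  obtain Q :: nat and F :: "(int \<Rightarrow> real) \<Rightarrow> nat \<Rightarrow> complex" where Q: "Q > 0" and F:
    "\<forall>g. complex_of_real (\<Sum>b\<in>?Sol. \<Prod>i<2*k. g i (b i)) =
       (\<Sum>z<Q. \<Prod>i<2*k. if i < k then F (g i) z else cnj (F (g i) z)) / of_nat Q"
    using solutions_fourier[OF B, where k = k] .
  have finSol: "finite ?Sol" using B(1) by (rule finite_multiplicative_solutions)
  have inB: "b i \<in> B" if "b \<in> ?Sol" "i < 2 * k" for b i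
    using that unfolding multiplicative_solutions_def by (auto simp: PiE_iff)
  \<comment> \<open>With one weight at all positions the factors pair with their conjugates, so the
    energy is the mean of |F v|^(2k).\<close>
  have diag: "(\<Sum>z<Q. (cmod (F v z) ^ 2) ^ k) = real Q * (\<Sum>b\<in>?Sol. \<Prod>i<2*k. v (b i))" for v
  proof -
    have "(\<Prod>i<2*k. if i < k then F v z else cnj (F v z)) = complex_of_real ((cmod (F v z) ^ 2) ^ k)" for z
    proof -
      have "{..<2*k} \<inter> {i. i < k} = {..<k}" "{..<2*k} \<inter> - {i. i < k} = {k..<2*k}" by auto
      then have "(\<Prod>i<2*k. if i < k then F v z else cnj (F v z)) = F v z ^ k * cnj (F v z) ^ k"
        by (simp add: prod.If_cases)
      also have "\<dots> = (F v z * cnj (F v z)) ^ k" by (simp add: power_mult_distrib)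
      also have "F v z * cnj (F v z) = complex_of_real (cmod (F v z) ^ 2)"
        by (rule complex_norm_square[symmetric])
      finally show ?thesis by simp
    qed
    then have "complex_of_real (real Q * (\<Sum>b\<in>?Sol. \<Prod>i<2*k. v (b i))) =
        complex_of_real (\<Sum>z<Q. (cmod (F v z) ^ 2) ^ k)"
      using F[rule_format, of "\<lambda>_. v"] Q by simp
    then show ?thesis by (simp only: of_real_eq_iff)
  qed
  define E where "E = weighted_energy k w B"
  have E_sum: "E = (\<Sum>b\<in>?Sol. \<Prod>i<2*k. w (b i))"
    unfolding E_def by (rule weighted_energy_eq_sum_solutions)
  have E0: "E \<ge> 0" unfolding E_def using w by (intro weighted_energy_nonneg) auto
  define W where "W j = (\<lambda>b. if c b = j then w b else 0)" for j
  define S where "S j = (\<Sum>b\<in>{b \<in> B. c b = j}. (w b)\<^sup>2)" for j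
  have S0: "S j \<ge> 0" for j unfolding S_def by (intro sum_nonneg) auto
  \<comment> \<open>Cutting \<open>w\<close> off outside a class produces the energy of that class,
    to which \<open>cls\<close> applies.\<close>
  have cls_bound: "(\<Sum>z<Q. (cmod (F (W j) z) ^ 2) ^ k) \<le> real Q * (M * S j) ^ k" for j
  proof -
    have "(\<Sum>b\<in>?Sol. \<Prod>i<2*k. W j (b i)) =
        (\<Sum>b\<in>multiplicative_solutions k {b \<in> B. c b = j}. \<Prod>i<2*k. w (b i))"
    proof (rule sum.mono_neutral_cong_right[OF finSol])
      show "multiplicative_solutions k {b \<in> B. c b = j} \<subseteq> ?Sol"
        unfolding multiplicative_solutions_def by (auto simp: PiE_iff)
      show "\<forall>b\<in>?Sol - multiplicative_solutions k {b \<in> B. c b = j}. (\<Prod>i<2*k. W j (b i)) = 0"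
      proof
        fix b assume "b \<in> ?Sol - multiplicative_solutions k {b \<in> B. c b = j}"
        then obtain i where "i < 2 * k" "c (b i) \<noteq> j"
          unfolding multiplicative_solutions_def by (auto simp: PiE_iff)
        then show "(\<Prod>i<2*k. W j (b i)) = 0"
          by (intro prod_zero) (auto simp: W_def)
      qed
      show "(\<Prod>i<2*k. W j (b i)) = (\<Prod>i<2*k. w (b i))"
        if "b \<in> multiplicative_solutions k {b \<in> B. c b = j}" for b
        using that unfolding multiplicative_solutions_def
        by (intro prod.cong) (auto simp: W_def PiE_iff)
    qed
    also have "\<dots> = weighted_energy k w {b \<in> B. c b = j}"
      by (rule weighted_energy_eq_sum_solutions[symmetric])
    also have "\<dots> \<le> (M * S j) ^ k"
      unfolding S_def using cls[of j] w unfolding energy_bounded_def by blast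
    finally show ?thesis unfolding diag using Q by (intro mult_left_mono) auto
  qed
  define T where "T s t j = (\<Sum>b\<in>?Sol. \<Prod>i<2*k. (if i \<in> {s, t} then W j else w) (b i))"
    for s t :: nat and j
  \<comment> \<open>Absolute values remove the conjugations, so it does not matter on which sides of
    the equation \<open>s\<close> and \<open>t\<close> lie.\<close>
  have T_le: "T s t j \<le> (\<Sum>z<Q. cmod (F (W j) z) ^ 2 * (cmod (F w z) ^ 2) ^ (k - 1)) / real Q"
    if st: "s < t" "t < 2 * k" for s t j
  proof -
    define g where "g i = (if i \<in> {s, t} then W j else w)" for i
    have "cmod (\<Prod>i<2*k. if i < k then F (g i) z else cnj (F (g i) z)) =
        cmod (F (W j) z) ^ 2 * (cmod (F w z) ^ 2) ^ (k - 1)" for z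
    proof -
      have "cmod (\<Prod>i<2*k. if i < k then F (g i) z else cnj (F (g i) z)) =
          (\<Prod>i<2*k. if i \<in> {s, t} then cmod (F (W j) z) else cmod (F w z))"
        unfolding prod_norm[symmetric] by (intro prod.cong) (auto simp: g_def)
      also have "\<dots> = cmod (F (W j) z) ^ card ({..<2*k} \<inter> {i. i \<in> {s, t}}) *
          cmod (F w z) ^ card ({..<2*k} \<inter> - {i. i \<in> {s, t}})"
        by (subst prod.If_cases) auto
      also have "{..<2*k} \<inter> {i. i \<in> {s, t}} = {s, t}" using st by auto
      also have "{..<2*k} \<inter> - {i. i \<in> {s, t}} = {..<2*k} - {s, t}" by auto
      also have "card ({..<2*k} - {s, t}) = 2 * (k - 1)"
        using st by (subst card_Diff_subset) auto
      also have "card {s, t} = 2" using st by auto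
      finally show ?thesis by (simp add: power_mult)
    qed
    then have "cmod ((\<Sum>z<Q. \<Prod>i<2*k. if i < k then F (g i) z else cnj (F (g i) z)) / of_nat Q) \<le>
        (\<Sum>z<Q. cmod (F (W j) z) ^ 2 * (cmod (F w z) ^ 2) ^ (k - 1)) / real Q"
      unfolding norm_divide using Q
      by (auto intro!: divide_right_mono order.trans[OF norm_sum])
    moreover have "complex_of_real (T s t j) =
        (\<Sum>z<Q. \<Prod>i<2*k. if i < k then F (g i) z else cnj (F (g i) z)) / of_nat Q"
      unfolding T_def using F[rule_format, of g] unfolding g_def .
    ultimately have "cmod (complex_of_real (T s t j)) \<le>
        (\<Sum>z<Q. cmod (F (W j) z) ^ 2 * (cmod (F w z) ^ 2) ^ (k - 1)) / real Q"
      by simp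
    then show ?thesis by simp
  qed
  show "weighted_energy k w B \<le> (2 * real k ^ 2 * M * (\<Sum>b\<in>B. (w b)\<^sup>2)) ^ k"
  proof (cases "E = 0")
    case True
    then show ?thesis using M unfolding E_def by (simp add: sum_nonneg)
  next
    case False
    \<comment> \<open>Positive in this case, so that \<open>D ^ (k - 1)\<close> can be cancelled at
      the end.\<close>
    define D where "D = root k E"
    have D: "D > 0" "D ^ k = E" using k E0 False unfolding D_def by auto
    have Y: "(\<Sum>z<Q. (cmod (F w z) ^ 2) ^ k) \<le> real Q * D ^ k"
      unfolding diag D(2) E_sum ..
    have T_bound: "T s t j \<le> M * S j * D ^ (k - 1)" if "s < t" "t < 2 * k" for s t j
    proof -
      have "(\<Sum>z<Q. cmod (F (W j) z) ^ 2 * (cmod (F w z) ^ 2) ^ (k - 1)) \<le>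
          real Q * (M * S j * D ^ (k - 1))"
        using M S0 by (intro holder_sum_power[OF k _ _ _ D(1) _ cls_bound Y]) auto
      then have "(\<Sum>z<Q. cmod (F (W j) z) ^ 2 * (cmod (F w z) ^ 2) ^ (k - 1)) / real Q \<le>
          M * S j * D ^ (k - 1)"
        using Q by (subst pos_divide_le_eq) (simp_all add: mult_ac)
      then show ?thesis using T_le[OF that, of j] by linarith
    qed
    define P where "P = (SIGMA t:{..<2*k}. {..<t})"
    have finP: "finite P" unfolding P_def by simp
    have finC: "finite (c ` B)" using B by simp
    have term_nonneg: "0 \<le> (\<Prod>i<2*k. (if i \<in> {s, t} then W j else w) (b i))"
      if "b \<in> ?Sol" for b s t j
      using inB[OF that] w by (intro prod_nonneg) (auto simp: W_def)
    \<comment> \<open>A solution may have several pairs of equal colour; all terms are nonnegative,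
      so counting it for each of them only enlarges the sum.\<close>
    have "E \<le> (\<Sum>b\<in>?Sol. \<Sum>((t, s), j)\<in>P \<times> c ` B.
        \<Prod>i<2*k. (if i \<in> {s, t} then W j else w) (b i))"
      unfolding E_sum
    proof (rule sum_mono)
      fix b assume b: "b \<in> ?Sol"
      obtain s t where st: "s < t" "t < 2 * k" "c (b s) = c (b t)" using col[OF b] by blast
      have "(\<Prod>i<2*k. w (b i)) = (\<Prod>i<2*k. (if i \<in> {s, t} then W (c (b s)) else w) (b i))"
        using st(3) by (intro prod.cong) (auto simp: W_def)
      also have "\<dots> = (\<lambda>((t, s), j). \<Prod>i<2*k. (if i \<in> {s, t} then W j else w) (b i)) ((t, s), c (b s))"
        by simp
      also have "\<dots> \<le> (\<Sum>((t, s), j)\<in>P \<times> c ` B.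
        \<Prod>i<2*k. (if i \<in> {s, t} then W j else w) (b i))"
      proof (rule member_le_sum)
        have "b s \<in> B" using inB[OF b] st by simp
        then show "((t, s), c (b s)) \<in> P \<times> c ` B" using st(1,2) by (auto simp: P_def)
      qed (use finP finC term_nonneg[OF b] in auto)
      finally show "(\<Prod>i<2*k. w (b i)) \<le> (\<Sum>((t, s), j)\<in>P \<times> c ` B.
        \<Prod>i<2*k. (if i \<in> {s, t} then W j else w) (b i))" .
    qed
    also have "\<dots> = (\<Sum>((t, s), j)\<in>P \<times> c ` B. T s t j)"
      unfolding T_def by (subst sum.swap) (simp add: case_prod_unfold)
    also have "\<dots> \<le> (\<Sum>((t, s), j)\<in>P \<times> c ` B. M * S j * D ^ (k - 1))"
      by (intro sum_mono) (use T_bound in \<open>auto simp: P_def\<close>)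
    also have "\<dots> = (\<Sum>ts\<in>P. \<Sum>j\<in>c ` B. M * S j * D ^ (k - 1))"
      by (subst sum.cartesian_product) (simp add: case_prod_unfold)
    also have "\<dots> = real (card P) * (M * (\<Sum>j\<in>c ` B. S j) * D ^ (k - 1))"
      by (simp add: sum_distrib_left sum_distrib_right)
    also have "(\<Sum>j\<in>c ` B. S j) = (\<Sum>b\<in>B. (w b)\<^sup>2)"
      unfolding S_def using B(1) by (rule sum.image_gen[symmetric])
    also have "real (card P) * (M * (\<Sum>b\<in>B. (w b)\<^sup>2) * D ^ (k - 1)) \<le>
        2 * real k ^ 2 * (M * (\<Sum>b\<in>B. (w b)\<^sup>2) * D ^ (k - 1))"
      unfolding P_def using M D(1) by (intro mult_right_mono card_ordered_pairs) (auto intro!: mult_nonneg_nonneg sum_nonneg)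
    finally have "D * D ^ (k - 1) \<le> (2 * real k ^ 2 * M * (\<Sum>b\<in>B. (w b)\<^sup>2)) * D ^ (k - 1)"
      using k D(2) by (simp add: power_eq_if mult_ac)
    then have "D \<le> 2 * real k ^ 2 * M * (\<Sum>b\<in>B. (w b)\<^sup>2)" using D(1) by simp
    then have "D ^ k \<le> (2 * real k ^ 2 * M * (\<Sum>b\<in>B. (w b)\<^sup>2)) ^ k"
      using D(1) by (intro power_mono) auto
    then show ?thesis using D(2) unfolding E_def by simp
  qed
qed

text \<open>Dropping the equation leaves the sum over all tuples, the 2k-th power of the total
  weight; with at most one element, the square of the total weight is the sum of the
  squares.\<close>

lemma energy_bounded_card_le_1:
  assumes k: "k \<ge> 1" and B: "finite B" "card B \<le> 1"
  shows "energy_bounded k B 1"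
  unfolding energy_bounded_def
proof (intro allI impI)
  fix w :: "'a \<Rightarrow> real" assume w: "\<forall>b\<in>B. 0 \<le> w b"
  have "weighted_energy k w B \<le> (\<Sum>b\<in>{..<2*k} \<rightarrow>\<^sub>E B. \<Prod>i<2*k. w (b i))"
    unfolding weighted_energy_def using B(1) w
    by (intro sum_mono2 finite_PiE prod_nonneg) (auto dest: PiE_mem)
  also have "\<dots> = (\<Prod>i<2*k. \<Sum>b\<in>B. w b)" using B(1) by (subst prod_sum_PiE) auto
  also have "\<dots> = ((\<Sum>b\<in>B. w b)\<^sup>2) ^ k" by (simp add: power_mult)
  also have "(\<Sum>b\<in>B. w b)\<^sup>2 = (\<Sum>b\<in>B. (w b)\<^sup>2)"
    using B by (auto simp: le_Suc_eq card_1_singleton_iff)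
  finally show "weighted_energy k w B \<le> (1 * (\<Sum>b\<in>B. (w b)\<^sup>2)) ^ k" by simp
qed

subsection \<open>Shifts and valuations\<close>

text \<open>Modulo \<open>m\<close> all factors except the one at \<open>i0\<close> are
  \<open>u\<close>. Both products have equally many factors, so cancelling powers of the unit
  \<open>u\<close> leaves \<open>a i0 + u\<close> congruent to \<open>u\<close>.\<close>

lemma dvd_exceptional_factor:
  fixes a :: "'i \<Rightarrow> int"
  assumes fin: "finite I" "finite J" and card: "card I = card J" and i0: "i0 \<in> I"
    and I: "\<And>i. i \<in> I - {i0} \<Longrightarrow> m dvd a i" and J: "\<And>i. i \<in> J \<Longrightarrow> m dvd a i"
    and u: "coprime u m" and eq: "(\<Prod>i\<in>I. a i + u) = (\<Prod>i\<in>J. a i + u)"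
  shows "m dvd a i0"
proof -
  have cong: "[(\<Prod>i\<in>L. a i + u) = u ^ card L] (mod m)" if "\<And>i. i \<in> L \<Longrightarrow> m dvd a i" for L
  proof -
    have "[(\<Prod>i\<in>L. a i + u) = (\<Prod>i\<in>L. u)] (mod m)"
      using that by (intro cong_prod) (auto simp: cong_iff_dvd_diff)
    then show ?thesis by simp
  qed
  have "(\<Prod>i\<in>I. a i + u) = (a i0 + u) * (\<Prod>i\<in>I - {i0}. a i + u)"
    using fin(1) i0 by (rule prod.remove)
  moreover have "[(a i0 + u) * (\<Prod>i\<in>I - {i0}. a i + u) = (a i0 + u) * u ^ (card I - 1)] (mod m)"
    using cong[of "I - {i0}"] I i0 fin by (intro cong_mult) auto
  moreover have "[(\<Prod>i\<in>J. a i + u) = u * u ^ (card I - 1)] (mod m)"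
  proof -
    have "card I > 0" using fin i0 by (auto simp: card_gt_0_iff)
    then have "u * u ^ (card I - 1) = u ^ card J" unfolding card[symmetric] by (simp add: power_eq_if)
    then show ?thesis using cong[of J] J by simp
  qed
  ultimately have "[(a i0 + u) * u ^ (card I - 1) = u * u ^ (card I - 1)] (mod m)"
    using eq by (simp add: cong_def)
  then have "m dvd a i0 * u ^ (card I - 1)"
    by (simp add: cong_iff_dvd_diff algebra_simps)
  moreover have "coprime m (u ^ (card I - 1))" using u by (simp add: coprime_commute)
  ultimately show ?thesis by (simp add: coprime_dvd_mult_left_iff)
qed

lemma solution_repeated_exponent:
  assumes k: "k \<ge> 1" and pos: "\<And>a. a \<in> A \<Longrightarrow> a > 0" and cop: "\<And>a. a \<in> A \<Longrightarrow> coprime u a"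
    and b: "b \<in> multiplicative_solutions k (shift_set A u)"
  shows "\<exists>s t. s < t \<and> t < 2 * k \<and> prime_exponents (b s - u) p = prime_exponents (b t - u) p"
proof (rule ccontr)
  assume neg: "\<not> ?thesis"
  \<comment> \<open>If the minimal valuation \<open>j\<close> were attained only once, then modulo \<open>p ^ (j + 1)\<close> all factors
      but one would be congruent to \<open>u\<close>, forcing the exceptional one to be so as well.\<close>
  have distinct: "prime_exponents (b s - u) p \<noteq> prime_exponents (b t - u) p"
    if "s < 2 * k" "t < 2 * k" "s \<noteq> t" for s t
  proof (cases "s < t")
    case True
    then show ?thesis using neg that by blast
  next
    case False
    then have "t < s" using that by simp
    then show ?thesis using neg that by metis
  qed
  \<comment> \<open>For \<open>p\<close> not prime all exponents are 0, and the positions 0 and 1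
    already agree.\<close>
  have p: "prime p"
    using distinct[of 0 1] k unfolding prime_exponents_def by (auto split: if_splits)
  define a where "a i = b i - u" for i
  have aA: "a i \<in> A" if "i < 2 * k" for i
    using b that unfolding multiplicative_solutions_def a_def shift_set_def by (force simp: PiE_iff)
  define v where "v i = multiplicity p (a i)" for i
  have v_distinct: "v s \<noteq> v t" if "s < 2 * k" "t < 2 * k" "s \<noteq> t" for s t
    using distinct[OF that] p unfolding prime_exponents_def v_def a_def by simp
  have "Min (v ` {..<2*k}) \<in> v ` {..<2*k}" using k by (intro Min_in) (auto simp: lessThan_empty_iff)
  then obtain i0 where i0: "i0 < 2 * k" and "v i0 = Min (v ` {..<2*k})" by auto
  then have min: "v i0 \<le> v i" if "i < 2 * k" for i using that by simp
  have dvd: "p ^ Suc (v i0) dvd a i" if "i < 2 * k" "i \<noteq> i0" for i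
  proof -
    have "Suc (v i0) \<le> v i" using min[OF that(1)] v_distinct[OF that(1) i0 that(2)] by simp
    then show ?thesis unfolding v_def by (rule multiplicity_dvd')
  qed
  have "\<not> p ^ Suc (v i0) dvd a i0"
    unfolding v_def using pos[OF aA[OF i0]] p
    by (subst power_dvd_iff_le_multiplicity) auto
  moreover have "p ^ Suc (v i0) dvd a i0"
  proof -
    \<comment> \<open>A second position supplies an element of \<open>A\<close> that is divisible by
      \<open>p\<close>; as \<open>u\<close> is coprime to this element, \<open>p\<close> does not
      divide \<open>u\<close>.\<close>
    obtain i1 where i1: "i1 < 2 * k" "i1 \<noteq> i0"
      using k that[of 0] that[of 1] by (cases "i0 = 0") auto
    have "p dvd p ^ Suc (v i0)" by simp
    then have "p dvd a i1" using dvd[OF i1] by (rule dvd_trans)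
    then have "\<not> p dvd u" using cop[OF aA[OF i1(1)]] p coprime_common_divisor[of u "a i1" p] not_prime_unit by blast
    then have "coprime p u" using p by (intro prime_imp_coprime)
    then have u: "coprime u (p ^ Suc (v i0))"
      by (simp only: coprime_power_right_iff coprime_commute[of u p]) simp
    have eq: "(\<Prod>i<k. a i + u) = (\<Prod>i=k..<2*k. a i + u)"
      using b unfolding multiplicative_solutions_def a_def by simp
    show ?thesis
    proof (cases "i0 < k")
      case True
      show ?thesis
        by (rule dvd_exceptional_factor[OF _ _ _ _ _ _ u eq]) (use True dvd in auto)
    next
      case False
      show ?thesis
        by (rule dvd_exceptional_factor[OF _ _ _ _ _ _ u eq[symmetric]]) (use False i0 dvd in auto)
    qed
  qed
  ultimately show False by blast
qed

text \<open>Induction on \<open>P\<close> with \<open>A\<close> varying: splitting by the exponent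
  at one \<open>p\<close> costs a factor 2 k^2 and leaves classes that the remaining coordinates
  separate. With no coordinates left, a class has at most one element.\<close>

lemma energy_bounded_shift:
  assumes "finite P" and k: "k \<ge> 1" and "finite A"
    and "\<And>a. a \<in> A \<Longrightarrow> a > 0" and "\<And>a. a \<in> A \<Longrightarrow> coprime u a"
    and "0 \<notin> shift_set A u"
    and "\<And>a b. a \<in> A \<Longrightarrow> b \<in> A \<Longrightarrow> (\<And>p. p \<in> P \<Longrightarrow> prime_exponents a p = prime_exponents b p) \<Longrightarrow> a = b"
  shows "energy_bounded k (shift_set A u) ((2 * real k ^ 2) ^ card P)"
  using assms(1,3-)
proof (induction P arbitrary: A)
  case empty
  have "a = b" if "a \<in> A" "b \<in> A" for a b using empty.prems(5)[OF that] by simp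
  then have "card A \<le> 1" by (simp add: card_le_Suc0_iff_eq empty.prems(1))
  then have "card (shift_set A u) \<le> 1"
    unfolding shift_set_def by (rule le_trans[OF card_image_le[OF empty.prems(1)]])
  then have "energy_bounded k (shift_set A u) 1"
    using empty.prems(1) by (intro energy_bounded_card_le_1 k) (auto simp: shift_set_def)
  then show ?case by simp
next
  case (insert p P)
  have classes: "energy_bounded k {b \<in> shift_set A u. prime_exponents (b - u) p = j} ((2 * real k ^ 2) ^ card P)" for j
  proof -
    define A' where "A' = {a \<in> A. prime_exponents a p = j}"
    have "energy_bounded k (shift_set A' u) ((2 * real k ^ 2) ^ card P)"
    proof (rule insert.IH)
      show "0 \<notin> shift_set A' u" using insert.prems(4) unfolding A'_def shift_set_def by auto
      show "a = b" if ab: "a \<in> A'" "b \<in> A'"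
        and eq: "\<And>q. q \<in> P \<Longrightarrow> prime_exponents a q = prime_exponents b q" for a b
      proof (rule insert.prems(5))
        show "a \<in> A" "b \<in> A" using ab unfolding A'_def by auto
        show "prime_exponents a q = prime_exponents b q" if "q \<in> insert p P" for q
          using ab eq[of q] that unfolding A'_def by (cases "q = p") auto
      qed
    qed (use insert.prems(1-3) A'_def in auto)
    moreover have "shift_set A' u = {b \<in> shift_set A u. prime_exponents (b - u) p = j}"
      unfolding A'_def shift_set_def by auto
    ultimately show ?thesis by simp
  qed
  have "energy_bounded k (shift_set A u) (2 * real k ^ 2 * (2 * real k ^ 2) ^ card P)"
  proof (rule energy_bounded_colouring[OF k _ insert.prems(4) _ _ classes])
    show "finite (shift_set A u)" using insert.prems(1) by (simp add: shift_set_def)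
  qed (use solution_repeated_exponent[OF k insert.prems(2,3)] in auto)
  then show ?case using insert.hyps by simp
qed

section \<open>From energy bounds to \<open>Lambda_const\<close> and to iterated product
  sets\<close>

lemma Lambda_const_le:
  fixes B :: "'a::comm_monoid_mult set"
  assumes "k \<ge> 1" "finite B" "B \<noteq> {}" "M \<ge> 0" "energy_bounded k B M"
  shows "Lambda_const k B \<le> M"
proof -
  obtain w where w: "w \<in> unit_weights B" "Lambda_const k B = weighted_energy k w B powr (1 / real k)"
    using Lambda_const_is_max[OF assms(2,3)] by blast
  have "weighted_energy k w B \<le> (M * 1) ^ k"
    using assms(5) w(1) unfolding energy_bounded_def unit_weights_def by (metis (mono_tags, lifting) mem_Collect_eq)
  then have "weighted_energy k w B powr (1 / real k) \<le> (M ^ k) powr (1 / real k)"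
    using w(1) by (intro powr_mono2 weighted_energy_nonneg) (auto simp: unit_weights_def)
  also have "\<dots> = M"
  proof (cases "M = 0")
    case True
    then show ?thesis using assms(1) by simp
  next
    case False
    then have "M > 0" using assms(4) by simp
    then show ?thesis using assms(1) by (simp add: powr_realpow[symmetric] powr_powr)
  qed
  finally show ?thesis using w(2) by simp
qed

lemma iterated_product_set_eq_image:
  "iterated_product_set B k = (\<lambda>b. \<Prod>i<k. b i) ` ({..<k} \<rightarrow>\<^sub>E B)"
proof (intro equalityI subsetI)
  fix x assume "x \<in> iterated_product_set B k"
  then obtain b where b: "x = (\<Prod>i<k. b i)" "\<forall>i<k. b i \<in> B" unfolding iterated_product_set_def by blast
  have "x = (\<Prod>i<k. restrict b {..<k} i)" using b(1) by simp
  moreover have "restrict b {..<k} \<in> {..<k} \<rightarrow>\<^sub>E B" using b(2) by auto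
  ultimately show "x \<in> (\<lambda>b. \<Prod>i<k. b i) ` ({..<k} \<rightarrow>\<^sub>E B)" by blast
next
  fix x assume "x \<in> (\<lambda>b. \<Prod>i<k. b i) ` ({..<k} \<rightarrow>\<^sub>E B)"
  then show "x \<in> iterated_product_set B k" unfolding iterated_product_set_def by (auto simp: PiE_iff)
qed

text \<open>Cauchy-Schwarz for the numbers \<open>r y\<close> of representations of
  \<open>y\<close>: their sum is |B|^k, and the sum of their squares is at most the energy with all
  weights 1, hence at most (M |B|)^k.\<close>

lemma card_iterated_product_set_ge:
  fixes B :: "'a::comm_monoid_mult set"
  assumes B: "finite B" and M: "M > 0" and eb: "energy_bounded k B M"
  shows "real (card B) ^ k / M ^ k \<le> real (card (iterated_product_set B k))"
proof (cases "card B = 0 \<and> k \<noteq> 0")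
  case True
  then show ?thesis by (simp add: power_0_left)
next
  case False
  define X where "X = {..<k} \<rightarrow>\<^sub>E B"
  define \<pi> where "\<pi> b = (\<Prod>i<k. b i)" for b :: "nat \<Rightarrow> 'a"
  have finX: "finite X" unfolding X_def using B by (intro finite_PiE) auto
  have cardX: "card X = card B ^ k" unfolding X_def by (simp add: card_PiE)
  have img: "iterated_product_set B k = \<pi> ` X"
    unfolding iterated_product_set_eq_image X_def \<pi>_def ..
  define r where "r y = card {x \<in> X. \<pi> x = y}" for y
  have sum_r: "(\<Sum>y\<in>\<pi> ` X. r y) = card X"
    unfolding r_def using sum.image_gen[OF finX, of "\<lambda>_. 1::nat" \<pi>] by simp
  have "(\<Sum>y\<in>\<pi> ` X. r y * r y) \<le> card (multiplicative_solutions k B)"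
  proof -
    define Z where "Z = (SIGMA y:\<pi> ` X. {x \<in> X. \<pi> x = y} \<times> {x \<in> X. \<pi> x = y})"
    have cardZ: "card Z = (\<Sum>y\<in>\<pi> ` X. r y * r y)"
      unfolding Z_def r_def using finX by (subst card_SigmaI) (auto simp: card_cartesian_product)
    \<comment> \<open>\<open>h\<close> concatenates two k-tuples with the same product
      \<open>y\<close> into one solution.\<close>
    define h where "h = (\<lambda>(y :: 'a, f, g). \<lambda>i\<in>{..<2*k}. if i < k then f i else g (i - k) :: 'a)"
    have h1: "h (y, f, g) i = f i" if "i < k" for y f g i using that unfolding h_def by simp
    have h2: "h (y, f, g) (i + k) = g i" if "i < k" for y f g i using that unfolding h_def by simp
    have "inj_on h Z"
    proof (rule inj_onI)
      fix z z' assume zz: "z \<in> Z" "z' \<in> Z" "h z = h z'"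
      obtain y f g y' f' g' where z: "z = (y, f, g)" "z' = (y', f', g')"
        by (cases z, cases z') auto
      have mem: "f \<in> X" "g \<in> X" "f' \<in> X" "g' \<in> X" "\<pi> f = y" "\<pi> f' = y'"
        using zz z unfolding Z_def by auto
      have "f i = f' i" if "i < k" for i using h1[OF that] zz(3) z by metis
      then have "f = f'" using mem unfolding X_def by (intro PiE_ext[of f _ "\<lambda>_. B" f']) auto
      moreover have "g i = g' i" if "i < k" for i using h2[OF that] zz(3) z by metis
      then have "g = g'" using mem unfolding X_def by (intro PiE_ext[of g _ "\<lambda>_. B" g']) auto
      ultimately show "z = z'" using mem z by simp
    qed
    moreover have "h ` Z \<subseteq> multiplicative_solutions k B"
    proof
      fix b assume "b \<in> h ` Z"
      then obtain y f g where z: "b = h (y, f, g)" "f \<in> X" "g \<in> X" "\<pi> f = \<pi> g"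
        unfolding Z_def by auto
      have "b \<in> {..<2*k} \<rightarrow>\<^sub>E B"
        using z(2,3) unfolding z(1) h_def X_def by (auto simp: PiE_iff)
      moreover have "(\<Prod>i<k. b i) = \<pi> f" unfolding \<pi>_def z(1) by (intro prod.cong) (auto simp: h1)
      moreover have "(\<Prod>i=k..<2*k. b i) = \<pi> g"
      proof -
        have "(\<Prod>i=k..<2*k. b i) = (\<Prod>i=0+k..<k+k. b i)" by (simp add: mult_2)
        also have "\<dots> = (\<Prod>i=0..<k. b (i + k))" by (rule prod.shift_bounds_nat_ivl)
        also have "\<dots> = \<pi> g" unfolding \<pi>_def z(1) lessThan_atLeast0 by (intro prod.cong) (auto simp: h2)
        finally show ?thesis .
      qed
      ultimately show "b \<in> multiplicative_solutions k B"
        unfolding multiplicative_solutions_def using z(4) by simp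
    qed
    moreover have "finite (multiplicative_solutions k B)"
      using B by (rule finite_multiplicative_solutions)
    ultimately show ?thesis unfolding cardZ[symmetric] by (rule card_inj_on_le)
  qed
  then have "(\<Sum>y\<in>\<pi> ` X. (real (r y))\<^sup>2) \<le> real (card (multiplicative_solutions k B))"
    unfolding power2_eq_square of_nat_mult[symmetric] of_nat_sum[symmetric] of_nat_le_iff .
  also have "\<dots> = weighted_energy k (\<lambda>_. 1) B"
    unfolding weighted_energy_eq_sum_solutions by simp
  also have "\<dots> \<le> (M * real (card B)) ^ k"
    using eb[unfolded energy_bounded_def, rule_format, of "\<lambda>_. 1"] by simp
  finally have energy: "(\<Sum>y\<in>\<pi> ` X. (real (r y))\<^sup>2) \<le> (M * real (card B)) ^ k" .
  have "(real (card B) ^ k)\<^sup>2 = (\<Sum>y\<in>\<pi> ` X. 1 * real (r y))\<^sup>2"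
    using sum_r cardX by (simp flip: of_nat_sum)
  also have "\<dots> \<le> (\<Sum>y\<in>\<pi> ` X. 1\<^sup>2) * (\<Sum>y\<in>\<pi> ` X. (real (r y))\<^sup>2)"
    by (rule Cauchy_Schwarz_ineq_sum)
  also have "\<dots> \<le> real (card (\<pi> ` X)) * (M * real (card B)) ^ k"
    using energy by (simp add: mult_left_mono)
  finally have "real (card B) ^ k * real (card B) ^ k \<le> real (card (\<pi> ` X)) * M ^ k * real (card B) ^ k"
    by (simp add: power2_eq_square power_mult_distrib mult_ac)
  \<comment> \<open>This covers \<open>k = 0\<close>, where the power is 1 even for empty
    \<open>B\<close>.\<close>
  moreover have "real (card B) ^ k > 0" using False by auto
  ultimately have "real (card B) ^ k \<le> real (card (\<pi> ` X)) * M ^ k" by (simp only: mult_le_cancel_right_pos)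
  then show ?thesis unfolding img using M by (subst pos_divide_le_eq) auto
qed

text \<open>The bound on \<open>Lambda_const\<close> is for shifts that avoid 0: with 0 in the
  shifted set every tuple with a zero on both sides is a solution, and for k >= 2 the constant grows
  with |A|. The bound on the product set survives because 0 can be removed first.\<close>

theorem theorem10:
  fixes K :: int
  shows "\<exists>N0::nat. \<forall>A::int set.
    finite A \<longrightarrow> (\<forall>a\<in>A. 0 < a) \<longrightarrow>
    int (card (product_set A)) \<le> K * int (card A) \<longrightarrow> N0 \<le> card A \<longrightarrow>
    (\<forall>k::nat. 1 \<le> k \<longrightarrow>
      (\<forall>u::int. (\<forall>a\<in>A. coprime u a) \<longrightarrow>
        (0 \<notin> shift_set A u \<longrightarrow>
           Lambda_const k (shift_set A u) \<le> (2 * real k ^ 2) powi K) \<and>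
        real (card (iterated_product_set (shift_set A u) k))
          \<ge> real (card A) ^ k / (2 * real k ^ 2) powi (int k * K)))"
proof (intro exI[of _ "nat (2 * K\<^sup>2 + 2)"] allI impI)
  fix A :: "int set" and k :: nat and u :: int
  assume A: "finite A" "\<forall>a\<in>A. 0 < a" and dbl: "int (card (product_set A)) \<le> K * int (card A)"
    and large: "nat (2 * K\<^sup>2 + 2) \<le> card A" and k: "1 \<le> k" and cop: "\<forall>a\<in>A. coprime u a"
  \<comment> \<open>The threshold exceeds 2 K^2, as the dimension bound requires, and guarantees the
    two elements needed when 0 is removed.\<close>
  have large': "2 * K\<^sup>2 + 2 \<le> int (card A)" using large by linarith
  define d where "d = mult_dim A"
  have d: "int d < K"
    unfolding d_def using A dbl large' by (intro mult_dim_less_doubling) auto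
  obtain P where P: "finite P" "card P = d" "determining P (ratio_group A)"
    unfolding d_def using mult_dim_attained[OF A(1)] .
  have sep: "a = b" if ab: "a \<in> A" "b \<in> A" "\<And>p. p \<in> P \<Longrightarrow> prime_exponents a p = prime_exponents b p" for a b
  proof -
    have "\<forall>p\<in>P. (prime_exponents a - prime_exponents b) p = 0" using ab(3) by simp
    then have "prime_exponents a - prime_exponents b = 0"
      using P(3) ratio_group_memI[OF ab(1,2)] unfolding determining_def by blast
    then have "prime_exponents a = prime_exponents b" by simp
    then show ?thesis using A(2) ab(1,2) by (intro prime_exponents_inject) auto
  qed
  define c where "c = 2 * real k ^ 2"
  have "real k ^ 2 \<ge> 1" using k by simp
  then have c: "c \<ge> 2" unfolding c_def by simp
  \<comment> \<open>From 0 <= d < K the exponent \<open>K\<close> is positive, so the integer powers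
    become natural ones.\<close>
  define n where "n = nat K"
  have n: "K = int n" "d < n" using d unfolding n_def by auto
  \<comment> \<open>Stated for subsets in order to serve both \<open>A\<close> itself and
    \<open>A\<close> without \<open>- u\<close>.\<close>
  have eb: "energy_bounded k (shift_set A' u) (c ^ d)"
    if "A' \<subseteq> A" "0 \<notin> shift_set A' u" for A'
  proof -
    have A': "\<And>a. a \<in> A' \<Longrightarrow> a \<in> A" using that(1) by (rule subsetD)
    show ?thesis
      unfolding c_def P(2)[symmetric]
    proof (rule energy_bounded_shift[OF P(1) k finite_subset[OF that(1) A(1)] _ _ that(2)])
      show "a > 0" "coprime u a" if "a \<in> A'" for a
        using A(2) cop A'[OF that] by simp_all
    qed (rule sep[OF A' A'])
  qed
  have fin: "finite (shift_set A' u)" if "A' \<subseteq> A" for A'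
    unfolding shift_set_def using that A(1) finite_subset by blast
  have card_shift: "card (shift_set A' u) = card A'" for A'
    unfolding shift_set_def by (intro card_image) (auto simp: inj_on_def)
  have ne: "A \<noteq> {}" using large' zero_le_power2[of K] by (intro notI) simp
  have "Lambda_const k (shift_set A u) \<le> (2 * real k ^ 2) powi K" if "0 \<notin> shift_set A u"
  proof -
    have "Lambda_const k (shift_set A u) \<le> c ^ d"
      using eb[OF order.refl that] fin[OF order.refl] ne c
      by (intro Lambda_const_le k) (auto simp: shift_set_def)
    also have "\<dots> \<le> c ^ n" using c n by (intro power_increasing) auto
    finally show ?thesis unfolding n(1) power_int_of_nat c_def .
  qed
  moreover have "real (card A) ^ k / (2 * real k ^ 2) powi (int k * K)
      \<le> real (card (iterated_product_set (shift_set A u) k))"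
  proof -
    \<comment> \<open>Zero may lie in the shifted set; removing it costs at most a factor \<open>2 ^ k\<close>, which the strict
        inequality \<open>d < K\<close> absorbs.\<close>
    define A' where "A' = A - {- u}"
    have A': "A' \<subseteq> A" "0 \<notin> shift_set A' u" unfolding A'_def shift_set_def by auto
    have "card A \<le> Suc (card A')"
      unfolding A'_def using A(1) by (cases "- u \<in> A") (auto simp: card_Diff_singleton card_gt_0_iff)
    moreover have "card A \<ge> 2" using large' zero_le_power2[of K] by linarith
    ultimately have half: "real (card A) / 2 \<le> real (card A')" by linarith
    have "real (card A) ^ k / (2 * real k ^ 2) powi (int k * K) = real (card A) ^ k / (c ^ n) ^ k"
      unfolding n(1) c_def[symmetric] of_nat_mult[symmetric] power_int_of_nat power_mult[symmetric]
        mult.commute[of k n] ..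
    also have "\<dots> \<le> real (card A) ^ k / (c ^ d * 2) ^ k"
    proof -
      have "c ^ d * 2 \<le> c ^ d * c" using c by (intro mult_left_mono) auto
      also have "\<dots> = c ^ Suc d" by simp
      also have "\<dots> \<le> c ^ n" using c n by (intro power_increasing) auto
      finally show ?thesis using c by (intro divide_left_mono power_mono mult_pos_pos zero_less_power) auto
    qed
    also have "\<dots> = (real (card A) / 2) ^ k / (c ^ d) ^ k"
      by (simp add: power_divide power_mult_distrib)
    also have "\<dots> \<le> real (card A') ^ k / (c ^ d) ^ k"
      using half c by (intro divide_right_mono power_mono) auto
    also have "\<dots> \<le> real (card (iterated_product_set (shift_set A' u) k))"
      using card_iterated_product_set_ge[OF fin[OF A'(1)] _ eb[OF A']] c by (simp add: card_shift)
    also have "\<dots> \<le> real (card (iterated_product_set (shift_set A u) k))"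
    proof -
      have "iterated_product_set (shift_set A' u) k \<subseteq> iterated_product_set (shift_set A u) k"
        using A'(1) unfolding iterated_product_set_def shift_set_def by blast
      moreover have "finite (iterated_product_set (shift_set A u) k)"
        unfolding iterated_product_set_eq_image using fin[OF order.refl] by (intro finite_imageI finite_PiE) auto
      ultimately show ?thesis by (simp add: card_mono)
    qed
    finally show ?thesis .
  qed
  ultimately show "(0 \<notin> shift_set A u \<longrightarrow> Lambda_const k (shift_set A u) \<le> (2 * real k ^ 2) powi K) \<and>
      real (card A) ^ k / (2 * real k ^ 2) powi (int k * K)
        \<le> real (card (iterated_product_set (shift_set A u) k))"
    by blast
qed

end
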